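(* Consider the Group-R2 prior with $G$ groups of sizes $p_1,\dots,p_G$, parameters $a_G>0$, $a_2>0$, $c_g=a_G/p_g$, and $\sigma^2=1$ (as defined in the context), and let $p(b_{gl})$ denote the marginal prior density of $b_{gl}$. As $|b_{gl}|\to0$, with $0<c_g\le1/2$ and $a_2>0$, the marginal prior densities are unbounded and exhibit a singularity at zero. Specifically, they satisfy $$p(b_{gl})\sim\begin{cases}c_1\,|b_{gl}|^{2c_g-1}+\mathcal{O}\left(|b_{gl}|^{2c_g+1}\right), & c_g<\tfrac12,\\[2pt] -c_2\,\ln(b_{gl}^2)+\mathcal{O}\left(b_{gl}^2\ln(b_{gl}^2)\right), & c_g=\tfrac12,\end{cases}$$ where $c_1,c_2>0$. Conversely, when $c_g>\tfrac12$, the marginal prior densities are bounded and continuous at zero. Furthermore, they are differentiable at $b_{gl}=0$ for all $c_g\ge1$.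
   Context: Group-R2 prior (with $\sigma^2=1$): $R^2\sim\mathrm{Beta}(Ga_G,a_2)$ and $\tau^2=R^2/(1-R^2)$; $\phi=(\phi_1,\dots,\phi_G)$ is symmetric Dirichlet with all concentration parameters equal to $a_G$; for each $g$, $\varphi_g=(\varphi_{g1},\dots,\varphi_{gp_g})$ is symmetric Dirichlet with all concentration parameters equal to $c_g$; the variables $\tau^2,\phi,\varphi_1,\dots,\varphi_G$ are mutually independent; and conditionally on them the coefficients $b_{gl}$ are independent with $b_{gl}\sim\mathrm{Normal}(0,\varphi_{gl}\phi_g\tau^2)$ (variance parametrization). The subscript in $a_G$ is only a label. $c_1,c_2$ are constants not depending on $b_{gl}$ (not to be confused with the concentration parameters $c_g$).
   Formalization: At c_g=1 the density has a kink at 0, so differentiability is proved for c_g>1 and only one-sidedly at c_g=1; the O-terms bound the remainder of p only up to an additive constant, since equality without it fails (the stated "~" is also proved). *)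

theory Defs
  imports "HOL-Probability.Probability" "HOL-Library.Landau_Symbols"
begin

definition beta_density :: "real \<Rightarrow> real \<Rightarrow> real \<Rightarrow> real" where
  "beta_density a b x =
     (if 0 < x \<and> x < 1 then x powr (a - 1) * (1 - x) powr (b - 1) / Beta a b else 0)"

text \<open>
  The Dirichlet distribution with concentration parameters \<open>\<alpha> 0, \<dots>, \<alpha> (K - 1)\<close>, given by its
  usual density with respect to Lebesgue measure in the first \<open>K - 1\<close> coordinates of the
  simplex; the last coordinate is one minus their sum. For \<open>K = 1\<close> there are no free
  coordinates and the result is the point mass at \<open>1\<close>.
\<close>

definition dirichlet_density :: "nat \<Rightarrow> (nat \<Rightarrow> real) \<Rightarrow> (nat \<Rightarrow> real) \<Rightarrow> real" where
  "dirichlet_density K \<alpha> x =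
     (if (\<forall>i<K - 1. 0 < x i) \<and> (\<Sum>i<K - 1. x i) < 1
      then Gamma (\<Sum>i<K. \<alpha> i) / (\<Prod>i<K. Gamma (\<alpha> i))
           * (\<Prod>i<K - 1. x i powr (\<alpha> i - 1)) * (1 - (\<Sum>i<K - 1. x i)) powr (\<alpha> (K - 1) - 1)
      else 0)"

definition dirichlet :: "nat \<Rightarrow> (nat \<Rightarrow> real) \<Rightarrow> (nat \<Rightarrow> real) measure" where
  "dirichlet K \<alpha> =
     distr (density (\<Pi>\<^sub>M i\<in>{..<K - 1}. lborel) (\<lambda>x. ennreal (dirichlet_density K \<alpha> x)))
       (\<Pi>\<^sub>M i\<in>{..<K}. borel)
       (\<lambda>x. \<lambda>i\<in>{..<K}. if i < K - 1 then x i else 1 - (\<Sum>j<K - 1. x j))"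

text \<open>
  Groups are indexed by \<open>g < G\<close> and the coefficients of group \<open>g\<close> by \<open>l < p g\<close>. A point of
  the hyperparameter space is a triple \<open>(R2, \<phi>, \<psi>)\<close>, where \<open>\<psi> g\<close> stands for \<open>\<varphi>\<^sub>g\<close>;
  mutual independence is expressed by the product measure.
\<close>

type_synonym hyper = "real \<times> (nat \<Rightarrow> real) \<times> (nat \<Rightarrow> nat \<Rightarrow> real)"

definition group_R2_hyper :: "nat \<Rightarrow> (nat \<Rightarrow> nat) \<Rightarrow> real \<Rightarrow> real \<Rightarrow> hyper measure" where
  "group_R2_hyper G p aG a2 =
     density lborel (\<lambda>x. ennreal (beta_density (real G * aG) a2 x))
     \<Otimes>\<^sub>M (dirichlet G (\<lambda>_. aG)
     \<Otimes>\<^sub>M (\<Pi>\<^sub>M g\<in>{..<G}. dirichlet (p g) (\<lambda>_. aG / real (p g))))"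

definition coef_variance :: "hyper \<Rightarrow> nat \<Rightarrow> nat \<Rightarrow> real" where
  "coef_variance = (\<lambda>(R2, \<phi>, \<psi>) g l. \<psi> g l * \<phi> g * (R2 / (1 - R2)))"

definition coef_density :: "hyper \<Rightarrow> nat \<Rightarrow> nat \<Rightarrow> real \<Rightarrow> real" where
  "coef_density \<theta> g l = normal_density 0 (sqrt (coef_variance \<theta> g l))"

definition coef_indices :: "nat \<Rightarrow> (nat \<Rightarrow> nat) \<Rightarrow> (nat \<times> nat) set" where
  "coef_indices G p = (SIGMA g:{..<G}. {..<p g})"

text \<open>
  The joint law of hyperparameters and coefficients: given the hyperparameters, the
  coefficients have the product of the normal densities as their joint Lebesgue density.
\<close>

definition group_R2_prior ::
    "nat \<Rightarrow> (nat \<Rightarrow> nat) \<Rightarrow> real \<Rightarrow> real \<Rightarrow> (hyper \<times> (nat \<times> nat \<Rightarrow> real)) measure" where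
  "group_R2_prior G p aG a2 =
     density (group_R2_hyper G p aG a2 \<Otimes>\<^sub>M (\<Pi>\<^sub>M i\<in>coef_indices G p. lborel))
       (\<lambda>(\<theta>, b). ennreal (\<Prod>(g, l)\<in>coef_indices G p. coef_density \<theta> g l (b (g, l))))"

text \<open>
  The marginal density of a single coefficient, obtained by integrating its conditional density
  over the hyperparameters. This fixes one version of a density that is otherwise determined
  only almost everywhere. Where the integral diverges (which can happen only at \<open>b = 0\<close>), the
  Bochner integral returns \<open>0\<close>; statements about behaviour near \<open>0\<close> must use the punctured
  filter \<open>at 0\<close> there.
\<close>

definition coef_marginal_density ::
    "nat \<Rightarrow> (nat \<Rightarrow> nat) \<Rightarrow> real \<Rightarrow> real \<Rightarrow> nat \<Rightarrow> nat \<Rightarrow> real \<Rightarrow> real" where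
  "coef_marginal_density G p aG a2 g l b =
     (\<integral>\<theta>. coef_density \<theta> g l b \<partial>group_R2_hyper G p aG a2)"

end

theory Submission
  imports Defs
begin

text \<open>
  The odds of a beta variable are a ratio of independent gamma variables, and multiplying a gamma
  variable by an independent Dirichlet component gives a gamma variable with a smaller shape. Both
  Dirichlet layers therefore collapse: the variance of a coefficient is distributed as \<open>X / Y\<close> with
  independent \<open>X \<sim> Gamma(c)\<close> and \<open>Y \<sim> Gamma(a\<^sub>2)\<close>. Integrating out everything except the precision
  \<open>u = Y / X\<close> yields, up to a positive constant,
  \<open>p(b) = \<integral> u powr (a\<^sub>2 - 1/2) * (1 + u) powr - (c + a\<^sub>2) * exp (- b\<^sup>2 u / 2) du\<close> over \<open>u > 0\<close>.
  The behaviour at \<open>b = 0\<close> is governed by the tail \<open>u powr (- c - 1/2)\<close> of the weight. The difference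
  between weight and tail decays one power faster, so it contributes a constant plus a remainder,
  which is controlled by
  \<open>\<integral> u powr (- 1 - q) * (1 - exp (- s u)) du = Gamma (1 - q) / q * s powr q\<close> for \<open>0 < q < 1\<close>.
\<close>

text \<open>The layers collapse because the parameters fit. The first beta parameter
  \<open>real G * aG\<close> is the total concentration of the group proportions, and
  \<open>aG\<close>, the concentration of one group, is the total concentration of the
  \<open>p g\<close> entries \<open>aG / real (p g)\<close> inside it. So the gamma shape passes
  from \<open>real G * aG\<close> to \<open>aG\<close> to \<open>c\<close>, and only
  \<open>c\<close> and \<open>a2\<close> survive. The Laplace variable is
  \<open>s = b\<^sup>2 / 2\<close>, so a term \<open>s powr q\<close> becomes a multiple of
  \<open>\<bar>b\<bar> powr (2 * q)\<close>. Comparison with a pure power is confined to 0 < q < 1: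
  integrability at infinity forces q > 0, integrability at 0 forces q < 1. This separates the cases.
  For \<open>c < 1/2\<close> the tail has a Laplace transform of its own and the deficit of the
  weight has q = c + 1/2. For \<open>c = 1/2\<close> the tail is not integrable at 0 and the deficit
  sits at the excluded q = 1; both effects produce logarithms. For \<open>c > 1/2\<close> the weight
  is integrable, and only its loss against the value at \<open>s = 0\<close> has to be
  estimated.\<close>

section \<open>Gamma and beta variables\<close>

text \<open>Cutting the power off at 0 lets integrals run over all of \<open>lborel\<close> without
  indicators: a product such as \<open>pos_powr a x * pos_powr b (s - x)\<close> carries its own
  domain, and scaling by a positive factor needs no condition on \<open>x\<close>.\<close>

definition pos_powr :: "real \<Rightarrow> real \<Rightarrow> real" where
  "pos_powr a x = (if 0 < x then x powr a else 0)"

lemma pos_powr_nonneg [simp]: "0 \<le> pos_powr a x"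
  by (simp add: pos_powr_def)

lemma pos_powr_nonpos [simp]: "x \<le> 0 \<Longrightarrow> pos_powr a x = 0"
  by (simp add: pos_powr_def)

lemma pos_powr_pos: "0 < x \<Longrightarrow> pos_powr a x = x powr a"
  by (simp add: pos_powr_def)

lemma borel_measurable_pos_powr [measurable (raw)]:
  assumes [measurable]: "f \<in> borel_measurable M"
  shows "(\<lambda>x. pos_powr a (f x)) \<in> borel_measurable M"
  unfolding pos_powr_def by measurable

lemma pos_powr_mult: "0 < m \<Longrightarrow> pos_powr a (m * x) = m powr a * pos_powr a x"
  by (auto simp: pos_powr_def powr_mult zero_less_mult_iff)

lemma pos_powr_mult_pos_powr: "pos_powr a x * pos_powr b x = pos_powr (a + b) x"
  by (simp add: pos_powr_def powr_add)

lemma nn_integral_pos_powr_exp: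
  assumes "0 < a" "0 < s"
  shows "(\<integral>\<^sup>+u. ennreal (pos_powr (a - 1) u * exp (- (s * u))) \<partial>lborel) = ennreal (Gamma a * s powr - a)"
proof -
  have "(\<integral>\<^sup>+u. ennreal (pos_powr (a - 1) u * exp (- (s * u))) \<partial>lborel)
      = ennreal (1 / s) * (\<integral>\<^sup>+u. ennreal (pos_powr (a - 1) (1 / s * u) * exp (- u)) \<partial>lborel)"
    using assms by (subst nn_integral_real_affine[where c = "1 / s" and t = 0]) auto
  also have "\<dots> = ennreal (1 / s) * (\<integral>\<^sup>+u. ennreal ((1 / s) powr (a - 1))
      * ennreal (indicator {0..} u * u powr (a - 1) / exp u) \<partial>lborel)"
    using assms
    by (intro arg_cong2[where f = "(*)"] nn_integral_cong refl, subst pos_powr_mult)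
       (auto simp: pos_powr_def indicator_def exp_minus field_simps simp flip: ennreal_mult')
  also have "\<dots> = ennreal (1 / s * ((1 / s) powr (a - 1) * Gamma a))"
    using assms Gamma_real_pos[OF assms(1)]
    by (subst nn_integral_cmult) (auto simp flip: Gamma_conv_nn_integral_real ennreal_mult')
  also have "1 / s * ((1 / s) powr (a - 1) * Gamma a) = Gamma a * s powr - a"
    using assms by (simp add: powr_diff powr_divide powr_minus field_simps)
  finally show ?thesis .
qed

lemma Beta_real_pos: "0 < a \<Longrightarrow> 0 < b \<Longrightarrow> 0 < (Beta a b :: real)"
  by (simp add: Beta_def Gamma_real_pos)

lemma nn_integral_Beta:
  assumes "0 < a" "0 < b"
  shows "(\<integral>\<^sup>+r. ennreal (pos_powr (a - 1) r * pos_powr (b - 1) (1 - r)) \<partial>lborel) = ennreal (Beta a b)"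
proof -
  have "(\<integral>\<^sup>+r. ennreal (pos_powr (a - 1) r * pos_powr (b - 1) (1 - r)) \<partial>lborel)
      = (\<integral>\<^sup>+r. ennreal (indicator {0..1} r * (r powr (a - 1) * (1 - r) powr (b - 1))) \<partial>lborel)"
    by (intro nn_integral_cong) (auto simp: pos_powr_def indicator_def)
  also have "\<dots> = ennreal (Beta a b)"
    using nn_integral_has_integral_lebesgue[OF _ has_integral_Beta_real[OF assms]] by simp
  finally show ?thesis .
qed

text \<open>The substitution \<open>x = s * r\<close> turns the convolution into a beta integral.
  For \<open>s \<le> 0\<close> the conditions \<open>0 < x\<close> and \<open>x < s\<close> exclude
  each other, so both sides vanish.\<close>

lemma nn_integral_pos_powr_convolution:
  assumes "0 < a" "0 < b"
  shows "(\<integral>\<^sup>+x. ennreal (pos_powr (a - 1) x * pos_powr (b - 1) (s - x)) \<partial>lborel)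
       = ennreal (Beta a b * pos_powr (a + b - 1) s)"
proof (cases "0 < s")
  case True
  have "(\<integral>\<^sup>+x. ennreal (pos_powr (a - 1) x * pos_powr (b - 1) (s - x)) \<partial>lborel)
      = ennreal s * (\<integral>\<^sup>+r. ennreal (pos_powr (a - 1) (s * r) * pos_powr (b - 1) (s - s * r)) \<partial>lborel)"
    using True by (subst nn_integral_real_affine[where c = s and t = 0]) auto
  also have "\<dots> = ennreal s * (\<integral>\<^sup>+r. ennreal (s powr (a + b - 2))
      * ennreal (pos_powr (a - 1) r * pos_powr (b - 1) (1 - r)) \<partial>lborel)"
  proof (intro arg_cong2[where f = "(*)"] nn_integral_cong refl)
    fix r :: real
    have eq: "s - s * r = s * (1 - r)" by (simp add: algebra_simps)
    have "s powr (a + b - 2) = s powr (a - 1) * s powr (b - 1)"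
      by (simp flip: powr_add)
    then show "ennreal (pos_powr (a - 1) (s * r) * pos_powr (b - 1) (s - s * r))
        = ennreal (s powr (a + b - 2)) * ennreal (pos_powr (a - 1) r * pos_powr (b - 1) (1 - r))"
      unfolding eq pos_powr_mult[OF True] by (simp add: mult_ac flip: ennreal_mult')
  qed
  also have "\<dots> = ennreal (s * (s powr (a + b - 2) * Beta a b))"
    using True assms Beta_real_pos[of a b]
    by (subst nn_integral_cmult, simp, subst nn_integral_Beta) (auto simp flip: ennreal_mult')
  also have "s * (s powr (a + b - 2) * Beta a b) = Beta a b * pos_powr (a + b - 1) s"
    using True by (simp add: pos_powr_def powr_diff powr_add field_simps power2_eq_square)
  finally show ?thesis .
next
  case False
  have "(\<integral>\<^sup>+x. ennreal (pos_powr (a - 1) x * pos_powr (b - 1) (s - x)) \<partial>lborel) = (\<integral>\<^sup>+x. 0 \<partial>(lborel :: real measure))"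
    using False by (intro nn_integral_cong) (auto simp: pos_powr_def)
  then show ?thesis using False by simp
qed

section \<open>Gamma and beta laws as measures, and products and quotients of such variables\<close>

definition gamma_density :: "real \<Rightarrow> real \<Rightarrow> real" where
  "gamma_density a x = pos_powr (a - 1) x * exp (- x) / Gamma a"

definition gamma_distr :: "real \<Rightarrow> real measure" where
  "gamma_distr a = density lborel (\<lambda>x. ennreal (gamma_density a x))"

definition beta_distr :: "real \<Rightarrow> real \<Rightarrow> real measure" where
  "beta_distr a b = density lborel (\<lambda>x. ennreal (beta_density a b x))"

lemma beta_density_eq: "beta_density a b x = pos_powr (a - 1) x * pos_powr (b - 1) (1 - x) / Beta a b"
  by (simp add: beta_density_def pos_powr_def)

lemma borel_measurable_gamma_density [measurable]: "gamma_density a \<in> borel_measurable borel"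
  unfolding gamma_density_def by measurable

lemma borel_measurable_beta_density [measurable]: "beta_density a b \<in> borel_measurable borel"
  unfolding beta_density_eq by measurable

lemma gamma_density_nonneg: "0 < a \<Longrightarrow> 0 \<le> gamma_density a x"
  by (simp add: gamma_density_def Gamma_real_pos less_imp_le)

lemma sets_gamma_distr [simp, measurable_cong]: "sets (gamma_distr a) = sets borel"
  by (simp add: gamma_distr_def)

lemma sets_beta_distr [simp, measurable_cong]: "sets (beta_distr a b) = sets borel"
  by (simp add: beta_distr_def)

lemma space_gamma_distr [simp]: "space (gamma_distr a) = UNIV"
  by (simp add: gamma_distr_def)

lemma space_beta_distr [simp]: "space (beta_distr a b) = UNIV"
  by (simp add: beta_distr_def)

lemma prob_space_gamma_distr:
  assumes "0 < a"
  shows "prob_space (gamma_distr a)"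
proof
  have "emeasure (gamma_distr a) (space (gamma_distr a))
      = (\<integral>\<^sup>+x. ennreal (1 / Gamma a) * ennreal (pos_powr (a - 1) x * exp (- (1 * x))) \<partial>lborel)"
    using assms unfolding gamma_distr_def
    by (subst emeasure_density) (auto simp: gamma_density_def Gamma_real_pos less_imp_le simp flip: ennreal_mult')
  also have "\<dots> = ennreal (1 / Gamma a) * ennreal (Gamma a * 1 powr - a)"
    using assms by (subst nn_integral_cmult, simp, subst nn_integral_pos_powr_exp) auto
  also have "\<dots> = 1"
    using Gamma_real_pos[OF assms] by (simp flip: ennreal_mult')
  finally show "emeasure (gamma_distr a) (space (gamma_distr a)) = 1" .
qed

lemma prob_space_beta_distr:
  assumes "0 < a" "0 < b"
  shows "prob_space (beta_distr a b)"
proof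
  have "emeasure (beta_distr a b) (space (beta_distr a b))
      = (\<integral>\<^sup>+x. ennreal (1 / Beta a b) * ennreal (pos_powr (a - 1) x * pos_powr (b - 1) (1 - x)) \<partial>lborel)"
    using assms unfolding beta_distr_def
    by (subst emeasure_density) (auto simp: beta_density_eq Beta_real_pos less_imp_le simp flip: ennreal_mult')
  also have "\<dots> = ennreal (1 / Beta a b) * ennreal (Beta a b)"
    using assms by (subst nn_integral_cmult) (auto simp: nn_integral_Beta)
  also have "\<dots> = 1"
    using Beta_real_pos[OF assms] by (simp flip: ennreal_mult')
  finally show "emeasure (beta_distr a b) (space (beta_distr a b)) = 1" .
qed

lemma nn_integral_gamma_distr:
  assumes "0 < a" "f \<in> borel_measurable borel"
  shows "(\<integral>\<^sup>+x. f x \<partial>gamma_distr a) = (\<integral>\<^sup>+x. ennreal (gamma_density a x) * f x \<partial>lborel)"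
  unfolding gamma_distr_def using assms by (subst nn_integral_density) auto

lemma nn_integral_beta_distr:
  assumes "f \<in> borel_measurable borel"
  shows "(\<integral>\<^sup>+x. f x \<partial>beta_distr a b) = (\<integral>\<^sup>+x. ennreal (beta_density a b x) * f x \<partial>lborel)"
  unfolding beta_distr_def using assms by (subst nn_integral_density) auto

lemma AE_gamma_distr_pos: "AE x in gamma_distr a. 0 < x"
  unfolding gamma_distr_def
  by (subst AE_density) (auto simp: gamma_density_def pos_powr_def)

text \<open>A gamma variable times an independent beta fraction splits it into two independent gamma
  variables: substitute \<open>x = m r\<close> and \<open>m = x + y\<close>.\<close>

lemma nn_integral_gamma_beta:
  assumes ab: "0 < a" "0 < b" and K[measurable]: "(\<lambda>(x, y). K x y) \<in> borel_measurable (borel \<Otimes>\<^sub>M borel)"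
  shows "(\<integral>\<^sup>+m. \<integral>\<^sup>+r. K (m * r) (m * (1 - r)) \<partial>beta_distr a b \<partial>gamma_distr (a + b))
       = (\<integral>\<^sup>+x. \<integral>\<^sup>+y. K x y \<partial>gamma_distr b \<partial>gamma_distr a)" (is "?L = ?R")
proof -
  have pos: "0 < Gamma a" "0 < Gamma b" "0 < Gamma (a + b)" "0 < Beta a b"
    using ab by (auto simp: Gamma_real_pos Beta_real_pos)
  have Kxy[measurable]: "(\<lambda>x. K (f x) (g x)) \<in> borel_measurable M"
    if [measurable]: "f \<in> borel_measurable M" "g \<in> borel_measurable M" for f g :: "'a \<Rightarrow> real" and M
    using measurable_compose[OF _ K, of "\<lambda>x. (f x, g x)" M] by simp
  have "?R = (\<integral>\<^sup>+x. \<integral>\<^sup>+y. ennreal (gamma_density a x * gamma_density b y) * K x y \<partial>lborel \<partial>lborel)"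
    using ab by (simp add: nn_integral_gamma_distr gamma_density_nonneg ennreal_mult'' mult_ac
        flip: nn_integral_cmult)
  also have "\<dots> = (\<integral>\<^sup>+x. \<integral>\<^sup>+m. ennreal (gamma_density a x * gamma_density b (m - x)) * K x (m - x) \<partial>lborel \<partial>lborel)"
  proof (rule nn_integral_cong)
    fix x :: real
    show "(\<integral>\<^sup>+y. ennreal (gamma_density a x * gamma_density b y) * K x y \<partial>lborel)
       = (\<integral>\<^sup>+m. ennreal (gamma_density a x * gamma_density b (m - x)) * K x (m - x) \<partial>lborel)"
      by (subst nn_integral_real_affine[where c = 1 and t = "- x"]) auto
  qed
  also have "\<dots> = (\<integral>\<^sup>+m. \<integral>\<^sup>+x. ennreal (gamma_density a x * gamma_density b (m - x)) * K x (m - x) \<partial>lborel \<partial>lborel)"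
    by (rule lborel_pair.Fubini') measurable
  also have "\<dots> = (\<integral>\<^sup>+m. \<integral>\<^sup>+r. ennreal (gamma_density (a + b) m * beta_density a b r) * K (m * r) (m * (1 - r)) \<partial>lborel \<partial>lborel)"
  proof (rule nn_integral_cong)
    fix m :: real
    show "(\<integral>\<^sup>+x. ennreal (gamma_density a x * gamma_density b (m - x)) * K x (m - x) \<partial>lborel)
        = (\<integral>\<^sup>+r. ennreal (gamma_density (a + b) m * beta_density a b r) * K (m * r) (m * (1 - r)) \<partial>lborel)"
    proof (cases "0 < m")
      case True
      have "(\<integral>\<^sup>+x. ennreal (gamma_density a x * gamma_density b (m - x)) * K x (m - x) \<partial>lborel)
         = ennreal m * (\<integral>\<^sup>+r. ennreal (gamma_density a (m * r) * gamma_density b (m - m * r)) * K (m * r) (m - m * r) \<partial>lborel)"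
        using True by (subst nn_integral_real_affine[where c = m and t = 0]) auto
      also have "\<dots> = (\<integral>\<^sup>+r. ennreal (m * (gamma_density a (m * r) * gamma_density b (m - m * r))) * K (m * r) (m - m * r) \<partial>lborel)"
        using True by (subst nn_integral_cmult[symmetric]) (auto simp: ennreal_mult' mult_ac)
      also have "\<dots> = (\<integral>\<^sup>+r. ennreal (gamma_density (a + b) m * beta_density a b r) * K (m * r) (m * (1 - r)) \<partial>lborel)"
      proof (intro nn_integral_cong)
        fix r :: real
        have eq: "m - m * r = m * (1 - r)" by (simp add: algebra_simps)
        \<comment> \<open>The Jacobian \<open>m\<close> lifts the exponent
          \<open>(a - 1) + (b - 1)\<close> to \<open>a + b - 1\<close>.\<close>
        have p: "m * (m powr (a - 1) * m powr (b - 1)) = m powr (a + b - 1)"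
          using True by (simp add: powr_diff powr_add)
        have e: "exp (- (m * r)) * exp (- (m * (1 - r))) = exp (- m)"
          by (simp add: algebra_simps flip: exp_add)
        have "m * (gamma_density a (m * r) * gamma_density b (m * (1 - r)))
          = (m * (m powr (a - 1) * m powr (b - 1))) * (exp (- (m * r)) * exp (- (m * (1 - r))))
            * pos_powr (a - 1) r * pos_powr (b - 1) (1 - r) / (Gamma a * Gamma b)"
          using True by (simp add: gamma_density_def pos_powr_mult)
        also have "\<dots> = gamma_density (a + b) m * beta_density a b r"
          unfolding p e using True pos
          by (simp add: gamma_density_def pos_powr_pos beta_density_eq Beta_def field_simps)
        finally show "ennreal (m * (gamma_density a (m * r) * gamma_density b (m - m * r))) * K (m * r) (m - m * r)
           = ennreal (gamma_density (a + b) m * beta_density a b r) * K (m * r) (m * (1 - r))"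
          unfolding eq by simp
      qed
      finally show ?thesis .
    next
      case False
      then have "gamma_density a x * gamma_density b (m - x) = 0" "gamma_density (a + b) m = 0" for x
        by (auto simp: gamma_density_def pos_powr_def)
      then show ?thesis by (simp only: mult_zero_left ennreal_0 nn_integral_const)
    qed
  qed
  also have "\<dots> = ?L"
    using ab by (simp add: nn_integral_gamma_distr nn_integral_beta_distr gamma_density_nonneg
        ennreal_mult' mult.assoc flip: nn_integral_cmult)
  finally show ?thesis by simp
qed

text \<open>In \<open>nn_integral_gamma_beta\<close> the sum \<open>m\<close> of the two gamma
  variables cancels from \<open>(m * r) / (m * (1 - r))\<close>; the rest is constant in
  \<open>m\<close> and integrates against total mass 1. Cancelling needs
  \<open>m \<noteq> 0\<close>, which holds almost everywhere.\<close>

lemma nn_integral_beta_odds: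
  assumes ab: "0 < a" "0 < b" and [measurable]: "H \<in> borel_measurable borel"
  shows "(\<integral>\<^sup>+r. H (r / (1 - r)) \<partial>beta_distr a b) = (\<integral>\<^sup>+x. \<integral>\<^sup>+y. H (x / y) \<partial>gamma_distr b \<partial>gamma_distr a)"
proof -
  interpret prob_space "gamma_distr (a + b)" using ab by (simp add: prob_space_gamma_distr)
  have "(\<integral>\<^sup>+x. \<integral>\<^sup>+y. H (x / y) \<partial>gamma_distr b \<partial>gamma_distr a)
     = (\<integral>\<^sup>+m. \<integral>\<^sup>+r. H ((m * r) / (m * (1 - r))) \<partial>beta_distr a b \<partial>gamma_distr (a + b))"
    using ab by (subst nn_integral_gamma_beta) auto
  also have "\<dots> = (\<integral>\<^sup>+m. \<integral>\<^sup>+r. H (r / (1 - r)) \<partial>beta_distr a b \<partial>gamma_distr (a + b))"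
    by (rule nn_integral_cong_AE, rule AE_mp[OF AE_gamma_distr_pos]) (auto intro!: AE_I2 nn_integral_cong)
  also have "\<dots> = (\<integral>\<^sup>+r. H (r / (1 - r)) \<partial>beta_distr a b)"
    by (simp add: emeasure_space_1[simplified])
  finally show ?thesis by simp
qed

text \<open>The case of \<open>nn_integral_gamma_beta\<close> in which the integrand ignores the
  second gamma variable.\<close>

lemma nn_integral_gamma_thinning:
  assumes ab: "0 < a" "0 < b" and [measurable]: "H \<in> borel_measurable borel"
  shows "(\<integral>\<^sup>+r. \<integral>\<^sup>+m. H (r * m) \<partial>gamma_distr (a + b) \<partial>beta_distr a b) = (\<integral>\<^sup>+x. H x \<partial>gamma_distr a)"
proof -
  interpret A: prob_space "gamma_distr (a + b)" using ab by (simp add: prob_space_gamma_distr)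
  interpret B: prob_space "beta_distr a b" using ab by (simp add: prob_space_beta_distr)
  interpret C: prob_space "gamma_distr b" using ab by (simp add: prob_space_gamma_distr)
  interpret pair_sigma_finite "gamma_distr (a + b)" "beta_distr a b" ..
  have "(\<integral>\<^sup>+r. \<integral>\<^sup>+m. H (r * m) \<partial>gamma_distr (a + b) \<partial>beta_distr a b)
     = (\<integral>\<^sup>+m. \<integral>\<^sup>+r. H (m * r) \<partial>beta_distr a b \<partial>gamma_distr (a + b))"
    by (subst Fubini') (auto simp: mult_ac)
  also have "\<dots> = (\<integral>\<^sup>+x. \<integral>\<^sup>+y. H x \<partial>gamma_distr b \<partial>gamma_distr a)"
    using ab nn_integral_gamma_beta[of a b "\<lambda>x y. H x"] by simp
  also have "\<dots> = (\<integral>\<^sup>+x. H x \<partial>gamma_distr a)"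
    using C.emeasure_space_1 by simp
  finally show ?thesis .
qed

section \<open>Marginals of the symmetric Dirichlet distribution\<close>

text \<open>Dirichlet's integral over a simplex of size \<open>s\<close>. Fixing one coordinate
  \<open>y\<close> leaves the same integral at size \<open>s - y\<close>, hence the generalization
  over \<open>s\<close>. Each step is a beta convolution, and the gamma quotients telescope.\<close>

lemma nn_integral_simplex:
  assumes "finite J" "0 < \<alpha>" "0 < \<beta>"
  shows "(\<integral>\<^sup>+x. ennreal ((\<Prod>j\<in>J. pos_powr (\<alpha> - 1) (x j)) * pos_powr (\<beta> - 1) (s - (\<Sum>j\<in>J. x j)))
            \<partial>PiM J (\<lambda>_. lborel))
       = ennreal (Gamma \<alpha> ^ card J * Gamma \<beta> / Gamma (real (card J) * \<alpha> + \<beta>)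
                  * pos_powr (real (card J) * \<alpha> + \<beta> - 1) s)"
  using assms(1)
proof (induction J arbitrary: s rule: finite_induct)
  case empty
  interpret product_sigma_finite "\<lambda>_ :: 'a. lborel :: real measure" ..
  have "Gamma \<beta> \<noteq> 0" using Gamma_real_pos[OF \<open>0 < \<beta>\<close>] by simp
  then show ?case by (simp add: nn_integral_empty PiM_empty)
next
  case (insert i J)
  interpret product_sigma_finite "\<lambda>_ :: 'a. lborel :: real measure" ..
  let ?n = "real (card J)" and ?b = "real (card J) * \<alpha> + \<beta>"
  define C where "C = Gamma \<alpha> ^ card J * Gamma \<beta> / Gamma ?b"
  have b: "0 < ?b" using assms by (simp add: add_nonneg_pos)
  have C: "0 \<le> C" using assms b by (simp add: C_def Gamma_real_pos less_imp_le)
  have "(\<integral>\<^sup>+x. ennreal ((\<Prod>j\<in>insert i J. pos_powr (\<alpha> - 1) (x j))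
          * pos_powr (\<beta> - 1) (s - (\<Sum>j\<in>insert i J. x j))) \<partial>PiM (insert i J) (\<lambda>_. lborel))
      = (\<integral>\<^sup>+y. \<integral>\<^sup>+x. ennreal (pos_powr (\<alpha> - 1) y) * ennreal ((\<Prod>j\<in>J. pos_powr (\<alpha> - 1) (x j))
          * pos_powr (\<beta> - 1) ((s - y) - (\<Sum>j\<in>J. x j))) \<partial>PiM J (\<lambda>_. lborel) \<partial>lborel)"
  proof (subst product_nn_integral_insert_rev[OF insert.hyps], measurable, intro nn_integral_cong)
    fix y :: real and x :: "'a \<Rightarrow> real"
    have "(\<Prod>j\<in>J. pos_powr (\<alpha> - 1) ((x(i := y)) j)) = (\<Prod>j\<in>J. pos_powr (\<alpha> - 1) (x j))"
         "(\<Sum>j\<in>J. (x(i := y)) j) = (\<Sum>j\<in>J. x j)"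
      using insert.hyps by (auto intro!: prod.cong sum.cong)
    then show "ennreal ((\<Prod>j\<in>insert i J. pos_powr (\<alpha> - 1) ((x(i := y)) j))
          * pos_powr (\<beta> - 1) (s - (\<Sum>j\<in>insert i J. (x(i := y)) j)))
       = ennreal (pos_powr (\<alpha> - 1) y) * ennreal ((\<Prod>j\<in>J. pos_powr (\<alpha> - 1) (x j))
          * pos_powr (\<beta> - 1) ((s - y) - (\<Sum>j\<in>J. x j)))"
      using insert.hyps by (simp add: algebra_simps flip: ennreal_mult')
  qed
  also have "\<dots> = (\<integral>\<^sup>+y. ennreal C * ennreal (pos_powr (\<alpha> - 1) y * pos_powr (?b - 1) (s - y)) \<partial>lborel)"
  proof (rule nn_integral_cong)
    fix y :: real
    have "(\<integral>\<^sup>+x. ennreal (pos_powr (\<alpha> - 1) y) * ennreal ((\<Prod>j\<in>J. pos_powr (\<alpha> - 1) (x j))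
          * pos_powr (\<beta> - 1) ((s - y) - (\<Sum>j\<in>J. x j))) \<partial>PiM J (\<lambda>_. lborel))
       = ennreal (pos_powr (\<alpha> - 1) y) * ennreal (C * pos_powr (?b - 1) (s - y))"
      unfolding C_def by (subst nn_integral_cmult, measurable, subst insert.IH) simp
    then show "(\<integral>\<^sup>+x. ennreal (pos_powr (\<alpha> - 1) y) * ennreal ((\<Prod>j\<in>J. pos_powr (\<alpha> - 1) (x j))
          * pos_powr (\<beta> - 1) ((s - y) - (\<Sum>j\<in>J. x j))) \<partial>PiM J (\<lambda>_. lborel))
       = ennreal C * ennreal (pos_powr (\<alpha> - 1) y * pos_powr (?b - 1) (s - y))"
      using C by (simp add: mult_ac flip: ennreal_mult')
  qed
  also have "\<dots> = ennreal C * ennreal (Beta \<alpha> ?b * pos_powr (\<alpha> + ?b - 1) s)"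
    using assms b by (subst nn_integral_cmult, measurable, subst nn_integral_pos_powr_convolution) auto
  also have "\<dots> = ennreal (C * (Beta \<alpha> ?b * pos_powr (\<alpha> + ?b - 1) s))"
    using C by (simp flip: ennreal_mult')
  also have "C * (Beta \<alpha> ?b * pos_powr (\<alpha> + ?b - 1) s)
     = Gamma \<alpha> ^ card (insert i J) * Gamma \<beta> / Gamma (card (insert i J) * \<alpha> + \<beta>)
        * pos_powr (card (insert i J) * \<alpha> + \<beta> - 1) s"
    using insert.hyps Gamma_real_pos[OF b] by (simp add: C_def Beta_def algebra_simps)
  finally show ?case .
qed

text \<open>The supports of the \<open>pos_powr\<close> factors replace the case distinction of the
  definition, which makes the density a plain product.\<close>

lemma dirichlet_density_symmetric:
  "dirichlet_density K (\<lambda>_. \<alpha>) x = Gamma (real K * \<alpha>) / Gamma \<alpha> ^ K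
     * ((\<Prod>j<K - 1. pos_powr (\<alpha> - 1) (x j)) * pos_powr (\<alpha> - 1) (1 - (\<Sum>j<K - 1. x j)))"
proof (cases "(\<forall>i<K - 1. 0 < x i) \<and> (\<Sum>i<K - 1. x i) < 1")
  case True
  then show ?thesis by (simp add: dirichlet_density_def pos_powr_def)
next
  case False
  then have "(\<Prod>j<K - 1. pos_powr (\<alpha> - 1) (x j)) * pos_powr (\<alpha> - 1) (1 - (\<Sum>j<K - 1. x j)) = 0"
    by (auto simp: pos_powr_def)
  then show ?thesis using False unfolding dirichlet_density_def by (simp only: if_False mult_zero_right)
qed

lemma borel_measurable_dirichlet_density [measurable]:
  "dirichlet_density K (\<lambda>_. \<alpha>) \<in> borel_measurable (PiM {..<K - 1} (\<lambda>_. lborel))"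
  unfolding dirichlet_density_symmetric by measurable

lemma sets_dirichlet [simp, measurable_cong]: "sets (dirichlet K \<alpha>) = sets (PiM {..<K} (\<lambda>_. borel))"
  by (simp add: dirichlet_def)

section \<open>Isolating one free coordinate of the simplex\<close>

context
  fixes K k :: nat and \<alpha> :: real and F :: "real \<Rightarrow> ennreal"
  assumes k: "k < K - 1" and \<alpha>: "0 < \<alpha>" and F [measurable]: "F \<in> borel_measurable borel"
begin

interpretation product_sigma_finite "\<lambda>_ :: nat. lborel :: real measure" ..

lemma lessThan_remove: "{..<K - 1} = insert k ({..<K - 1} - {k})" "k \<notin> {..<K - 1} - {k}"
    "finite ({..<K - 1} - {k})"
  using k by auto

text \<open>With the other coordinates fixed, \<open>y\<close> and the last coordinate enter
  symmetrically. This one form yields both the marginal law of a free coordinate and the exchange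
  with the last one.\<close>

lemma dirichlet_density_fun_upd:
  "dirichlet_density K (\<lambda>_. \<alpha>) (x(k := y)) = Gamma (real K * \<alpha>) / Gamma \<alpha> ^ K
     * ((\<Prod>j\<in>{..<K - 1} - {k}. pos_powr (\<alpha> - 1) (x j))
        * (pos_powr (\<alpha> - 1) y * pos_powr (\<alpha> - 1) (1 - (\<Sum>j\<in>{..<K - 1} - {k}. x j) - y)))"
proof -
  have "(\<Prod>j<K - 1. pos_powr (\<alpha> - 1) ((x(k := y)) j))
     = pos_powr (\<alpha> - 1) y * (\<Prod>j\<in>{..<K - 1} - {k}. pos_powr (\<alpha> - 1) (x j))"
    using k by (subst prod.remove[where x = k]) (auto intro!: prod.cong)
  moreover have "(\<Sum>j<K - 1. (x(k := y)) j) = y + (\<Sum>j\<in>{..<K - 1} - {k}. x j)"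
    using k by (subst sum.remove[where x = k]) (auto intro!: sum.cong)
  ultimately show ?thesis by (simp add: dirichlet_density_symmetric algebra_simps)
qed

text \<open>For fixed \<open>y\<close> the other \<open>K - 2\<close> free coordinates range over a
  simplex of size \<open>1 - y\<close>. By \<open>nn_integral_simplex\<close> they contribute a
  power of \<open>1 - y\<close> with parameter \<open>real (K - 2) * \<alpha> + \<alpha>\<close>,
  which is the second beta parameter.\<close>

lemma nn_integral_dirichlet_density_free:
  "(\<integral>\<^sup>+x. ennreal (dirichlet_density K (\<lambda>_. \<alpha>) x) * F (x k) \<partial>PiM {..<K - 1} (\<lambda>_. lborel))
     = (\<integral>\<^sup>+r. F r \<partial>beta_distr \<alpha> (real (K - 1) * \<alpha>))"
proof -
  let ?J = "{..<K - 1} - {k}" and ?C = "Gamma (real K * \<alpha>) / Gamma \<alpha> ^ K"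
  have K: "2 \<le> K" using k by simp
  have J: "card ?J = K - 2" using k by simp
  have C: "0 \<le> ?C" using \<alpha> K by (simp add: Gamma_real_pos less_imp_le)
  have [measurable]: "(\<lambda>x. F (x k)) \<in> borel_measurable (PiM {..<K - 1} (\<lambda>_. lborel))"
    by measurable (use k in simp)
  have m: "(\<lambda>x. ennreal (dirichlet_density K (\<lambda>_. \<alpha>) x) * F (x k)) \<in> borel_measurable (PiM {..<K - 1} (\<lambda>_. lborel))"
    by measurable
  have "(\<integral>\<^sup>+x. ennreal (dirichlet_density K (\<lambda>_. \<alpha>) x) * F (x k) \<partial>PiM {..<K - 1} (\<lambda>_. lborel))
     = (\<integral>\<^sup>+y. \<integral>\<^sup>+x. ennreal (dirichlet_density K (\<lambda>_. \<alpha>) (x(k := y))) * F y \<partial>PiM ?J (\<lambda>_. lborel) \<partial>lborel)"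
    using product_nn_integral_insert_rev[OF lessThan_remove(3,2),
        of "\<lambda>x. ennreal (dirichlet_density K (\<lambda>_. \<alpha>) x) * F (x k)"]
    unfolding lessThan_remove(1)[symmetric] by (simp only: m fun_upd_same simp_thms)
  also have "\<dots> = (\<integral>\<^sup>+y. ennreal (beta_density \<alpha> (real (K - 1) * \<alpha>) y) * F y \<partial>lborel)"
  proof (rule nn_integral_cong)
    fix y :: real
    have "(\<integral>\<^sup>+x. ennreal (dirichlet_density K (\<lambda>_. \<alpha>) (x(k := y))) * F y \<partial>PiM ?J (\<lambda>_. lborel))
       = (\<integral>\<^sup>+x. (ennreal (?C * pos_powr (\<alpha> - 1) y) * F y) * ennreal ((\<Prod>j\<in>?J. pos_powr (\<alpha> - 1) (x j))
            * pos_powr (\<alpha> - 1) ((1 - y) - (\<Sum>j\<in>?J. x j))) \<partial>PiM ?J (\<lambda>_. lborel))"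
    proof (rule nn_integral_cong)
      fix x
      have "dirichlet_density K (\<lambda>_. \<alpha>) (x(k := y)) = (?C * pos_powr (\<alpha> - 1) y) * ((\<Prod>j\<in>?J. pos_powr (\<alpha> - 1) (x j))
            * pos_powr (\<alpha> - 1) ((1 - y) - (\<Sum>j\<in>?J. x j)))"
        unfolding dirichlet_density_fun_upd by (simp add: mult_ac) (simp add: algebra_simps)
      then have "ennreal (dirichlet_density K (\<lambda>_. \<alpha>) (x(k := y))) = ennreal (?C * pos_powr (\<alpha> - 1) y)
          * ennreal ((\<Prod>j\<in>?J. pos_powr (\<alpha> - 1) (x j)) * pos_powr (\<alpha> - 1) ((1 - y) - (\<Sum>j\<in>?J. x j)))"
        using C by (simp only: ennreal_mult' mult_nonneg_nonneg pos_powr_nonneg)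
      then show "ennreal (dirichlet_density K (\<lambda>_. \<alpha>) (x(k := y))) * F y
         = (ennreal (?C * pos_powr (\<alpha> - 1) y) * F y) * ennreal ((\<Prod>j\<in>?J. pos_powr (\<alpha> - 1) (x j))
            * pos_powr (\<alpha> - 1) ((1 - y) - (\<Sum>j\<in>?J. x j)))"
        by (simp add: mult_ac)
    qed
    also have "\<dots> = (ennreal (?C * pos_powr (\<alpha> - 1) y) * F y) *
        ennreal (Gamma \<alpha> ^ (K - 2) * Gamma \<alpha> / Gamma (real (K - 2) * \<alpha> + \<alpha>) * pos_powr (real (K - 2) * \<alpha> + \<alpha> - 1) (1 - y))"
      using \<alpha> by (subst nn_integral_cmult, measurable, subst nn_integral_simplex) (auto simp only: J finite_Diff finite_lessThan)
    also have "\<dots> = ennreal ((?C * pos_powr (\<alpha> - 1) y) *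
        (Gamma \<alpha> ^ (K - 2) * Gamma \<alpha> / Gamma (real (K - 2) * \<alpha> + \<alpha>) * pos_powr (real (K - 2) * \<alpha> + \<alpha> - 1) (1 - y))) * F y"
      by (subst ennreal_mult'[OF mult_nonneg_nonneg[OF C pos_powr_nonneg]]) (simp only: mult_ac)
    also have "(?C * pos_powr (\<alpha> - 1) y) *
        (Gamma \<alpha> ^ (K - 2) * Gamma \<alpha> / Gamma (real (K - 2) * \<alpha> + \<alpha>) * pos_powr (real (K - 2) * \<alpha> + \<alpha> - 1) (1 - y))
       = beta_density \<alpha> (real (K - 1) * \<alpha>) y"
    proof -
      \<comment> \<open>Removes the truncated subtractions \<open>K - 1\<close> and
        \<open>K - 2\<close>.\<close>
      obtain n where n: "K = n + 2" using K by (metis add.commute le_Suc_ex)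
      have "Gamma \<alpha> > 0" using \<alpha> by (rule Gamma_real_pos)
      then show ?thesis
        by (simp add: n beta_density_eq Beta_def algebra_simps)
    qed
    finally show "(\<integral>\<^sup>+x. ennreal (dirichlet_density K (\<lambda>_. \<alpha>) (x(k := y))) * F y \<partial>PiM ?J (\<lambda>_. lborel))
        = ennreal (beta_density \<alpha> (real (K - 1) * \<alpha>) y) * F y" .
  qed
  finally show ?thesis by (subst nn_integral_beta_distr) simp_all
qed

text \<open>The last coordinate of the simplex is exchanged with a free one by the reflection
  \<open>y \<mapsto> s - y\<close>, where \<open>s\<close> is one minus the remaining coordinates.\<close>

lemma nn_integral_dirichlet_density_last:
  "(\<integral>\<^sup>+x. ennreal (dirichlet_density K (\<lambda>_. \<alpha>) x) * F (1 - (\<Sum>j<K - 1. x j)) \<partial>PiM {..<K - 1} (\<lambda>_. lborel))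
     = (\<integral>\<^sup>+x. ennreal (dirichlet_density K (\<lambda>_. \<alpha>) x) * F (x k) \<partial>PiM {..<K - 1} (\<lambda>_. lborel))"
proof -
  let ?J = "{..<K - 1} - {k}"
  have ins: "integral\<^sup>N (PiM {..<K - 1} (\<lambda>_. lborel)) f
      = (\<integral>\<^sup>+x. \<integral>\<^sup>+y. f (x(k := y)) \<partial>lborel \<partial>PiM ?J (\<lambda>_. lborel))"
    if "f \<in> borel_measurable (PiM {..<K - 1} (\<lambda>_. lborel))" for f :: "(nat \<Rightarrow> real) \<Rightarrow> ennreal"
    using product_nn_integral_insert[OF lessThan_remove(3,2), of f] that
    unfolding lessThan_remove(1)[symmetric] by simp
  have sum: "(\<Sum>j<K - 1. (x(k := y)) j) = y + (\<Sum>j\<in>?J. x j)" for x :: "nat \<Rightarrow> real" and y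
    using k by (subst sum.remove[where x = k]) (auto intro!: sum.cong)
  have [measurable]: "(\<lambda>x. F (1 - (\<Sum>j<K - 1. x j))) \<in> borel_measurable (PiM {..<K - 1} (\<lambda>_. lborel))"
    "(\<lambda>x. F (x k)) \<in> borel_measurable (PiM {..<K - 1} (\<lambda>_. lborel))"
    by measurable (use k in simp)
  have "(\<integral>\<^sup>+x. ennreal (dirichlet_density K (\<lambda>_. \<alpha>) x) * F (1 - (\<Sum>j<K - 1. x j)) \<partial>PiM {..<K - 1} (\<lambda>_. lborel))
      = (\<integral>\<^sup>+x. \<integral>\<^sup>+y. ennreal (dirichlet_density K (\<lambda>_. \<alpha>) (x(k := y))) * F (1 - (y + (\<Sum>j\<in>?J. x j)))
           \<partial>lborel \<partial>PiM ?J (\<lambda>_. lborel))"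
    by (subst ins, measurable) (simp only: sum)
  also have "\<dots> = (\<integral>\<^sup>+x. \<integral>\<^sup>+y. ennreal (dirichlet_density K (\<lambda>_. \<alpha>) (x(k := y))) * F y
           \<partial>lborel \<partial>PiM ?J (\<lambda>_. lborel))"
  proof (rule nn_integral_cong)
    fix x :: "nat \<Rightarrow> real"
    let ?s = "1 - (\<Sum>j\<in>?J. x j)"
    show "(\<integral>\<^sup>+y. ennreal (dirichlet_density K (\<lambda>_. \<alpha>) (x(k := y))) * F (1 - (y + (\<Sum>j\<in>?J. x j))) \<partial>lborel)
        = (\<integral>\<^sup>+y. ennreal (dirichlet_density K (\<lambda>_. \<alpha>) (x(k := y))) * F y \<partial>lborel)"
      unfolding dirichlet_density_fun_upd
      by (subst nn_integral_real_affine[where c = "-1" and t = ?s], measurable)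
         (simp add: algebra_simps)
  qed
  also have "\<dots> = (\<integral>\<^sup>+x. ennreal (dirichlet_density K (\<lambda>_. \<alpha>) x) * F (x k) \<partial>PiM {..<K - 1} (\<lambda>_. lborel))"
    by (subst ins, measurable) (use k in \<open>simp_all only: fun_upd_same lessThan_iff\<close>)
  finally show ?thesis .
qed

end

lemma nn_integral_dirichlet:
  assumes "f \<in> borel_measurable (PiM {..<K} (\<lambda>_. borel))"
  shows "(\<integral>\<^sup>+x. f x \<partial>dirichlet K (\<lambda>_. \<alpha>)) = (\<integral>\<^sup>+x. ennreal (dirichlet_density K (\<lambda>_. \<alpha>) x)
     * f (\<lambda>i\<in>{..<K}. if i < K - 1 then x i else 1 - (\<Sum>j<K - 1. x j)) \<partial>PiM {..<K - 1} (\<lambda>_. lborel))"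
proof -
  have T[measurable]: "(\<lambda>x. \<lambda>i\<in>{..<K}. if i < K - 1 then x i else 1 - (\<Sum>j<K - 1. x j))
      \<in> PiM {..<K - 1} (\<lambda>_. lborel) \<rightarrow>\<^sub>M PiM {..<K} (\<lambda>_. borel)"
  proof (rule measurable_restrict)
    fix i
    show "(\<lambda>x. if i < K - 1 then x i else 1 - (\<Sum>j<K - 1. x j)) \<in> borel_measurable (PiM {..<K - 1} (\<lambda>_. lborel))"
      by (cases "i < K - 1") (auto intro!: measurable_component_singleton)
  qed
  show ?thesis
    unfolding dirichlet_def
    using assms T
    by (subst nn_integral_distr[where M' = "PiM {..<K} (\<lambda>_. borel)"])
       (auto simp del: One_nat_def intro!: nn_integral_density measurable_compose[OF T])
qed

lemma nn_integral_dirichlet_component: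
  assumes K: "2 \<le> K" and i: "i < K" and \<alpha>: "0 < \<alpha>" and F [measurable]: "F \<in> borel_measurable borel"
  shows "(\<integral>\<^sup>+x. F (x i) \<partial>dirichlet K (\<lambda>_. \<alpha>)) = (\<integral>\<^sup>+r. F r \<partial>beta_distr \<alpha> (real (K - 1) * \<alpha>))"
proof (cases "i < K - 1")
  case True
  have "(\<integral>\<^sup>+x. F (x i) \<partial>dirichlet K (\<lambda>_. \<alpha>))
     = (\<integral>\<^sup>+x. ennreal (dirichlet_density K (\<lambda>_. \<alpha>) x) * F (x i) \<partial>PiM {..<K - 1} (\<lambda>_. lborel))"
    using True i by (subst nn_integral_dirichlet) auto
  also have "\<dots> = (\<integral>\<^sup>+r. F r \<partial>beta_distr \<alpha> (real (K - 1) * \<alpha>))"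
    by (rule nn_integral_dirichlet_density_free[OF True \<alpha> F])
  finally show ?thesis .
next
  case False
  have pos: "0 < K - 1" using K by simp
  have "(\<integral>\<^sup>+x. F (x i) \<partial>dirichlet K (\<lambda>_. \<alpha>))
     = (\<integral>\<^sup>+x. ennreal (dirichlet_density K (\<lambda>_. \<alpha>) x) * F (1 - (\<Sum>j<K - 1. x j)) \<partial>PiM {..<K - 1} (\<lambda>_. lborel))"
    using False i by (subst nn_integral_dirichlet) auto
  also have "\<dots> = (\<integral>\<^sup>+r. F r \<partial>beta_distr \<alpha> (real (K - 1) * \<alpha>))"
    unfolding nn_integral_dirichlet_density_last[OF pos \<alpha> F] by (rule nn_integral_dirichlet_density_free[OF pos \<alpha> F])
  finally show ?thesis .
qed

text \<open>The product over the empty index set is a point mass; there the density is 1 and the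
  only component is \<open>1 - 0\<close>.\<close>

lemma nn_integral_dirichlet_singleton:
  assumes "0 < \<alpha>" "F \<in> borel_measurable borel"
  shows "(\<integral>\<^sup>+x. F (x 0) \<partial>dirichlet 1 (\<lambda>_. \<alpha>)) = F 1"
proof -
  interpret product_sigma_finite "\<lambda>_ :: nat. lborel :: real measure" ..
  show ?thesis
    using assms Gamma_real_pos[OF assms(1), THEN less_imp_neq, symmetric]
    by (subst nn_integral_dirichlet) (auto simp: nn_integral_empty dirichlet_density_symmetric pos_powr_def PiM_empty
        nn_integral_count_space_finite)
qed

text \<open>The total mass is read off the law of component 0, tested on the constant function
  1.\<close>

lemma prob_space_dirichlet:
  assumes "0 < K" "0 < \<alpha>"
  shows "prob_space (dirichlet K (\<lambda>_. \<alpha>))"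
proof
  have "(\<integral>\<^sup>+x. 1 \<partial>dirichlet K (\<lambda>_. \<alpha>)) = 1"
  proof (cases "K = 1")
    case True
    then show ?thesis using nn_integral_dirichlet_singleton[OF assms(2), of "\<lambda>_. 1"] by simp
  next
    case False
    then have K: "2 \<le> K" using assms by simp
    interpret prob_space "beta_distr \<alpha> (real (K - 1) * \<alpha>)"
      using K assms by (intro prob_space_beta_distr) auto
    show ?thesis
      using nn_integral_dirichlet_component[OF K _ assms(2), of 0 "\<lambda>_. 1"] assms emeasure_space_1 by simp
  qed
  then show "emeasure (dirichlet K (\<lambda>_. \<alpha>)) (space (dirichlet K (\<lambda>_. \<alpha>))) = 1"
    by (simp only: nn_integral_const mult_1)
qed

lemma borel_measurable_dirichlet_component [measurable (raw)]:
  "i < K \<Longrightarrow> (\<lambda>x. x i) \<in> borel_measurable (dirichlet K \<alpha>)"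
  using measurable_component_singleton[of i "{..<K}" "\<lambda>_. borel :: real measure"]
  by (simp add: measurable_cong_sets[OF sets_dirichlet refl])

text \<open>A component is beta distributed with parameters \<open>\<alpha>\<close> and
  \<open>real (K - 1) * \<alpha>\<close>, whose sum is the shape of the gamma variable: exactly the
  match that \<open>nn_integral_gamma_thinning\<close> asks for. For \<open>K = 1\<close> the
  component is the constant 1.\<close>

lemma nn_integral_dirichlet_gamma:
  assumes i: "i < K" and \<alpha>: "0 < \<alpha>" and H [measurable]: "H \<in> borel_measurable borel"
  shows "(\<integral>\<^sup>+x. \<integral>\<^sup>+m. H (x i * m) \<partial>gamma_distr (real K * \<alpha>) \<partial>dirichlet K (\<lambda>_. \<alpha>)) = (\<integral>\<^sup>+v. H v \<partial>gamma_distr \<alpha>)"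
proof -
  have "0 < real K * \<alpha>" using i \<alpha> by simp
  then interpret prob_space "gamma_distr (real K * \<alpha>)" by (rule prob_space_gamma_distr)
  have [measurable]: "(\<lambda>r. \<integral>\<^sup>+m. H (r * m) \<partial>gamma_distr (real K * \<alpha>)) \<in> borel_measurable borel" by measurable
  show ?thesis
  proof (cases "K = 1")
    case True
    then have "(\<lambda>r. \<integral>\<^sup>+m. H (r * m) \<partial>gamma_distr \<alpha>) \<in> borel_measurable borel"
      using \<open>(\<lambda>r. \<integral>\<^sup>+m. H (r * m) \<partial>gamma_distr (real K * \<alpha>)) \<in> _\<close> by simp
    then show ?thesis
      using nn_integral_dirichlet_singleton[OF \<alpha>, of "\<lambda>r. \<integral>\<^sup>+m. H (r * m) \<partial>gamma_distr \<alpha>"] i True by simp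
  next
    case False
    then have K: "2 \<le> K" using i by simp
    have eq: "real K * \<alpha> = \<alpha> + real (K - 1) * \<alpha>" using K by (simp add: of_nat_diff algebra_simps)
    show ?thesis
      using nn_integral_dirichlet_component[OF K i \<alpha>, of "\<lambda>r. \<integral>\<^sup>+m. H (r * m) \<partial>gamma_distr (real K * \<alpha>)"]
        nn_integral_gamma_thinning[of \<alpha> "real (K - 1) * \<alpha>" H] K \<alpha>
      unfolding eq[symmetric] by simp
  qed
qed

section \<open>The marginal prior of a coefficient\<close>

text \<open>Substitute \<open>y = x * u\<close> with Jacobian \<open>x\<close>; the integral over
  \<open>x\<close> is then a gamma integral of shape \<open>a + b\<close> and rate
  \<open>1 + u\<close>. The resulting density is that of the beta prime law with parameters
  \<open>b\<close> and \<open>a\<close>.\<close>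

lemma nn_integral_gamma_ratio:
  assumes ab: "0 < a" "0 < b" and [measurable]: "H \<in> borel_measurable borel"
  shows "(\<integral>\<^sup>+x. \<integral>\<^sup>+y. H (y / x) \<partial>gamma_distr b \<partial>gamma_distr a)
       = (\<integral>\<^sup>+u. ennreal (pos_powr (b - 1) u * (1 + u) powr - (a + b) / Beta a b) * H u \<partial>lborel)"
proof -
  have pos: "0 < Gamma a" "0 < Gamma b" "0 < Gamma (a + b)" "0 < Beta a b"
    using ab by (auto simp: Gamma_real_pos Beta_real_pos)
  define k where "k x u = x * (gamma_density a x * gamma_density b (x * u))" for x u
  have [measurable (raw)]: "(\<lambda>z. k (f z) (g z)) \<in> borel_measurable M"
    if [measurable]: "f \<in> borel_measurable M" "g \<in> borel_measurable M" for f g :: "'a \<Rightarrow> real" and M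
    unfolding k_def by measurable
  have k_eq: "k x u = 1 / (Gamma a * Gamma b) * pos_powr (b - 1) u
      * (pos_powr (a + b - 1) x * exp (- ((1 + u) * x)))" for x u
  proof (cases "0 < x")
    case True
    have "x * (x powr (a - 1) * x powr (b - 1)) = x powr (a + b - 1)"
      using True by (simp add: powr_diff powr_add)
    moreover have "exp (- x) * exp (- (x * u)) = exp (- ((1 + u) * x))"
      by (simp add: algebra_simps flip: exp_add)
    moreover have "k x u = 1 / (Gamma a * Gamma b) * pos_powr (b - 1) u
        * ((x * (x powr (a - 1) * x powr (b - 1))) * (exp (- x) * exp (- (x * u))))"
      using True by (simp add: k_def gamma_density_def pos_powr_mult pos_powr_pos)
    ultimately show ?thesis using True by (simp add: pos_powr_pos)
  qed (simp add: k_def gamma_density_def)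
  have "(\<integral>\<^sup>+x. \<integral>\<^sup>+y. H (y / x) \<partial>gamma_distr b \<partial>gamma_distr a)
      = (\<integral>\<^sup>+x. \<integral>\<^sup>+y. ennreal (gamma_density a x * gamma_density b y) * H (y / x) \<partial>lborel \<partial>lborel)"
    using ab by (simp add: nn_integral_gamma_distr gamma_density_nonneg ennreal_mult'' mult_ac
        flip: nn_integral_cmult)
  also have "\<dots> = (\<integral>\<^sup>+x. \<integral>\<^sup>+u. ennreal (k x u) * H u \<partial>lborel \<partial>lborel)"
  proof (rule nn_integral_cong)
    fix x :: real
    show "(\<integral>\<^sup>+y. ennreal (gamma_density a x * gamma_density b y) * H (y / x) \<partial>lborel)
       = (\<integral>\<^sup>+u. ennreal (k x u) * H u \<partial>lborel)"
    proof (cases "0 < x")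
      case True
      have "(\<integral>\<^sup>+y. ennreal (gamma_density a x * gamma_density b y) * H (y / x) \<partial>lborel)
         = ennreal x * (\<integral>\<^sup>+u. ennreal (gamma_density a x * gamma_density b (x * u)) * H u \<partial>lborel)"
        using True by (subst nn_integral_real_affine[where c = x and t = 0]) auto
      also have "\<dots> = (\<integral>\<^sup>+u. ennreal (k x u) * H u \<partial>lborel)"
        using True by (subst nn_integral_cmult[symmetric]) (auto simp: k_def ennreal_mult' mult_ac)
      finally show ?thesis .
    qed (simp add: k_def gamma_density_def)
  qed
  also have "\<dots> = (\<integral>\<^sup>+u. \<integral>\<^sup>+x. ennreal (k x u) * H u \<partial>lborel \<partial>lborel)"
    by (rule lborel_pair.Fubini') measurable
  also have "\<dots> = (\<integral>\<^sup>+u. ennreal (pos_powr (b - 1) u * (1 + u) powr - (a + b) / Beta a b) * H u \<partial>lborel)"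
  proof (rule nn_integral_cong)
    fix u :: real
    show "(\<integral>\<^sup>+x. ennreal (k x u) * H u \<partial>lborel)
        = ennreal (pos_powr (b - 1) u * (1 + u) powr - (a + b) / Beta a b) * H u"
    proof (cases "0 < u")
      case True
      let ?d = "1 / (Gamma a * Gamma b) * pos_powr (b - 1) u"
      have d: "0 \<le> ?d" using pos by simp
      have "(\<integral>\<^sup>+x. ennreal (k x u) * H u \<partial>lborel)
         = (\<integral>\<^sup>+x. ennreal ?d * ennreal (pos_powr (a + b - 1) x * exp (- ((1 + u) * x))) \<partial>lborel) * H u"
        unfolding k_eq using d by (subst nn_integral_multc) (auto simp only: ennreal_mult', measurable)
      also have "(\<integral>\<^sup>+x. ennreal ?d * ennreal (pos_powr (a + b - 1) x * exp (- ((1 + u) * x))) \<partial>lborel)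
         = ennreal ?d * ennreal (Gamma (a + b) * (1 + u) powr - (a + b))"
        using ab True by (subst nn_integral_cmult, measurable, subst nn_integral_pos_powr_exp) auto
      also have "\<dots> = ennreal (?d * (Gamma (a + b) * (1 + u) powr - (a + b)))"
        by (rule ennreal_mult'[OF d, symmetric])
      also have "?d * (Gamma (a + b) * (1 + u) powr - (a + b)) = pos_powr (b - 1) u * (1 + u) powr - (a + b) / Beta a b"
        using pos by (simp add: Beta_def)
      finally show ?thesis .
    qed (simp add: k_eq)
  qed
  finally show ?thesis .
qed

lemma group_R2_hyper_eq:
  "group_R2_hyper G p aG a2 = beta_distr (real G * aG) a2
     \<Otimes>\<^sub>M (dirichlet G (\<lambda>_. aG) \<Otimes>\<^sub>M (\<Pi>\<^sub>M g\<in>{..<G}. dirichlet (p g) (\<lambda>_. aG / real (p g))))"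
  by (simp add: group_R2_hyper_def beta_distr_def)

lemma coef_variance_eq:
  "coef_variance \<theta> g l = snd (snd \<theta>) g l * fst (snd \<theta>) g * (fst \<theta> / (1 - fst \<theta>))"
  by (simp add: coef_variance_def case_prod_beta)

lemma borel_measurable_PiM_dirichlet_component:
  "i \<in> I \<Longrightarrow> j < K i \<Longrightarrow> (\<lambda>x. x i j) \<in> borel_measurable (PiM I (\<lambda>i. dirichlet (K i) (\<alpha> i)))"
  using measurable_compose[OF measurable_component_singleton[of i I "\<lambda>i. dirichlet (K i) (\<alpha> i)"]
      borel_measurable_dirichlet_component[of j "K i" "\<alpha> i"]] by simp

lemma borel_measurable_coef_variance [measurable]:
  assumes "g < G" "l < p g"
  shows "(\<lambda>\<theta>. coef_variance \<theta> g l) \<in> borel_measurable (group_R2_hyper G p aG a2)"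
proof -
  have [measurable]: "(\<lambda>\<psi>. \<psi> g l) \<in> borel_measurable (\<Pi>\<^sub>M g\<in>{..<G}. dirichlet (p g) (\<lambda>_. aG / real (p g)))"
    using assms by (intro borel_measurable_PiM_dirichlet_component) auto
  have [measurable]: "(\<lambda>\<phi>. \<phi> g) \<in> borel_measurable (dirichlet G (\<lambda>_. aG))"
    using assms(1) by (rule borel_measurable_dirichlet_component)
  show ?thesis unfolding group_R2_hyper_eq coef_variance_eq by measurable
qed

lemma borel_measurable_coef_density [measurable (raw)]:
  assumes "g < G" "l < p g" and [measurable]: "\<theta> \<in> M \<rightarrow>\<^sub>M group_R2_hyper G p \<alpha> \<beta>" "b \<in> borel_measurable M"
  shows "(\<lambda>x. coef_density (\<theta> x) g l (b x)) \<in> borel_measurable M"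
proof -
  have [measurable]: "(\<lambda>x. coef_variance (\<theta> x) g l) \<in> borel_measurable M"
    by (rule measurable_compose[OF assms(3) borel_measurable_coef_variance]) fact+
  show ?thesis unfolding coef_density_def normal_density_def by measurable
qed

lemma coef_density_nonneg: "0 \<le> coef_density \<theta> g l b"
  by (simp add: coef_density_def)

locale group_R2 =
  fixes G :: nat and p :: "nat \<Rightarrow> nat" and aG a2 :: real
  assumes aG: "0 < aG" and a2: "0 < a2" and p: "\<And>h. h < G \<Longrightarrow> 0 < p h" and G: "0 < G"
begin

sublocale prob_space "group_R2_hyper G p aG a2"
proof -
  interpret A: prob_space "beta_distr (real G * aG) a2"
    using aG a2 G by (intro prob_space_beta_distr) auto
  interpret B: prob_space "dirichlet G (\<lambda>_. aG)"
    using aG G by (intro prob_space_dirichlet) auto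
  interpret C: prob_space "\<Pi>\<^sub>M g\<in>{..<G}. dirichlet (p g) (\<lambda>_. aG / real (p g))"
    using aG p by (intro prob_space_PiM prob_space_dirichlet) auto
  show "prob_space (group_R2_hyper G p aG a2)"
    unfolding group_R2_hyper_eq by (intro prob_space_pair) unfold_locales
qed

text \<open>The order of integration keeps the gamma variable innermost: the odds of R2 create it,
  then averaging over the group proportions and over the block of group \<open>g\<close> thins it
  twice.\<close>

lemma nn_integral_coef_variance:
  assumes g: "g < G" and l: "l < p g" and H [measurable]: "H \<in> borel_measurable borel"
  shows "(\<integral>\<^sup>+\<theta>. H (coef_variance \<theta> g l) \<partial>group_R2_hyper G p aG a2)
       = (\<integral>\<^sup>+x. \<integral>\<^sup>+y. H (x / y) \<partial>gamma_distr a2 \<partial>gamma_distr (aG / real (p g)))"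
proof -
  let ?A = "beta_distr (real G * aG) a2" and ?B = "dirichlet G (\<lambda>_. aG)"
  let ?C = "\<Pi>\<^sub>M g\<in>{..<G}. dirichlet (p g) (\<lambda>_. aG / real (p g))"
  interpret A: prob_space "?A" using aG a2 G by (intro prob_space_beta_distr) auto
  interpret B: prob_space "?B" using aG G by (intro prob_space_dirichlet) auto
  have pC: "prob_space (dirichlet (p h) (\<lambda>_. aG / real (p h)))" if "h \<in> {..<G}" for h
    using aG p that by (intro prob_space_dirichlet) auto
  interpret C: prob_space "?C" using pC by (rule prob_space_PiM)
  interpret BC: pair_sigma_finite "?B" "?C" ..
  interpret BC: prob_space "?B \<Otimes>\<^sub>M ?C" by (intro prob_space_pair) unfold_locales
  interpret ABC: pair_sigma_finite "?A" "?B \<Otimes>\<^sub>M ?C" ..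
  interpret D: prob_space "gamma_distr a2" using a2 by (rule prob_space_gamma_distr)
  interpret E: prob_space "gamma_distr (real G * aG)" using aG G by (intro prob_space_gamma_distr) auto
  interpret F: prob_space "gamma_distr aG" using aG by (rule prob_space_gamma_distr)
  \<comment> \<open>The average over the denominator is kept closed, since the collapses act on the
    numerator alone.\<close>
  define Q where "Q v = (\<integral>\<^sup>+y. H (v / y) \<partial>gamma_distr a2)" for v
  have Q [measurable]: "Q \<in> borel_measurable borel" unfolding Q_def by measurable
  have psi [measurable]: "(\<lambda>\<psi>. \<psi> g l) \<in> borel_measurable ?C"
    using g l by (intro borel_measurable_PiM_dirichlet_component) auto
  have [measurable]: "(\<lambda>\<phi>. \<phi> g) \<in> borel_measurable ?B"
    using g by (rule borel_measurable_dirichlet_component)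
  have [measurable]: "(\<lambda>z. H (coef_variance z g l)) \<in> borel_measurable (?A \<Otimes>\<^sub>M (?B \<Otimes>\<^sub>M ?C))"
    using borel_measurable_coef_variance[of g G l p aG a2] g l unfolding group_R2_hyper_eq by measurable
  have "(\<integral>\<^sup>+\<theta>. H (coef_variance \<theta> g l) \<partial>group_R2_hyper G p aG a2)
      = (\<integral>\<^sup>+z. \<integral>\<^sup>+r. H (coef_variance (r, z) g l) \<partial>?A \<partial>(?B \<Otimes>\<^sub>M ?C))"
    unfolding group_R2_hyper_eq by (subst ABC.nn_integral_snd[symmetric]) auto
  also have "\<dots> = (\<integral>\<^sup>+z. \<integral>\<^sup>+x. Q (snd z g l * (fst z g * x)) \<partial>gamma_distr (real G * aG) \<partial>(?B \<Otimes>\<^sub>M ?C))"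
  proof (rule nn_integral_cong)
    fix z :: "(nat \<Rightarrow> real) \<times> (nat \<Rightarrow> nat \<Rightarrow> real)"
    have "(\<integral>\<^sup>+r. H (coef_variance (r, z) g l) \<partial>?A)
       = (\<integral>\<^sup>+r. H (snd z g l * fst z g * (r / (1 - r))) \<partial>?A)"
      by (simp add: coef_variance_eq)
    also have "\<dots> = (\<integral>\<^sup>+x. \<integral>\<^sup>+y. H (snd z g l * fst z g * (x / y)) \<partial>gamma_distr a2 \<partial>gamma_distr (real G * aG))"
      using aG a2 G by (intro nn_integral_beta_odds) auto
    also have "\<dots> = (\<integral>\<^sup>+x. Q (snd z g l * (fst z g * x)) \<partial>gamma_distr (real G * aG))"
      by (simp add: Q_def mult.assoc)
    finally show "(\<integral>\<^sup>+r. H (coef_variance (r, z) g l) \<partial>?A)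
       = (\<integral>\<^sup>+x. Q (snd z g l * (fst z g * x)) \<partial>gamma_distr (real G * aG))" .
  qed
  also have "\<dots> = (\<integral>\<^sup>+\<psi>. \<integral>\<^sup>+\<phi>. \<integral>\<^sup>+x. Q (\<psi> g l * (\<phi> g * x)) \<partial>gamma_distr (real G * aG) \<partial>?B \<partial>?C)"
    by (subst BC.nn_integral_snd[symmetric]) auto
  also have "\<dots> = (\<integral>\<^sup>+\<psi>. \<integral>\<^sup>+x. Q (\<psi> g l * x) \<partial>gamma_distr aG \<partial>?C)"
    using aG g by (intro nn_integral_cong nn_integral_dirichlet_gamma) auto
  \<comment> \<open>Only the block of group \<open>g\<close> enters, so the product measure is
    replaced by its marginal on that block.\<close>
  also have "\<dots> = (\<integral>\<^sup>+\<xi>. \<integral>\<^sup>+x. Q (\<xi> l * x) \<partial>gamma_distr aG \<partial>distr ?C (dirichlet (p g) (\<lambda>_. aG / real (p g))) (\<lambda>\<psi>. \<psi> g))"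
  proof (rule nn_integral_distr[symmetric])
    show "(\<lambda>\<psi>. \<psi> g) \<in> ?C \<rightarrow>\<^sub>M dirichlet (p g) (\<lambda>_. aG / real (p g))"
      using measurable_component_singleton[of g "{..<G}" "\<lambda>g. dirichlet (p g) (\<lambda>_. aG / real (p g))"] g by simp
    have [measurable]: "(\<lambda>\<xi>. \<xi> l) \<in> borel_measurable (dirichlet (p g) (\<lambda>_. aG / real (p g)))"
      using l by (rule borel_measurable_dirichlet_component)
    show "(\<lambda>\<xi>. \<integral>\<^sup>+x. Q (\<xi> l * x) \<partial>gamma_distr aG)
       \<in> borel_measurable (distr ?C (dirichlet (p g) (\<lambda>_. aG / real (p g))) (\<lambda>\<psi>. \<psi> g))"
      by measurable
  qed
  also have "distr ?C (dirichlet (p g) (\<lambda>_. aG / real (p g))) (\<lambda>\<psi>. \<psi> g) = dirichlet (p g) (\<lambda>_. aG / real (p g))"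
    by (rule distr_PiM_component[OF pC]) (use g in auto)
  also have "(\<integral>\<^sup>+\<xi>. \<integral>\<^sup>+x. Q (\<xi> l * x) \<partial>gamma_distr aG \<partial>dirichlet (p g) (\<lambda>_. aG / real (p g)))
      = (\<integral>\<^sup>+v. Q v \<partial>gamma_distr (aG / real (p g)))"
    using nn_integral_dirichlet_gamma[OF l _ Q, of "aG / real (p g)"] aG p[OF g] by simp
  finally show ?thesis unfolding Q_def .
qed

text \<open>Needed for the joint law: at variance 0 \<open>normal_density\<close> is the constant 0,
  because of division by zero, and does not integrate to 1.\<close>

lemma AE_coef_variance_pos:
  assumes g: "g < G" and l: "l < p g"
  shows "AE \<theta> in group_R2_hyper G p aG a2. 0 < coef_variance \<theta> g l"
proof -
  have [measurable]: "(\<lambda>\<theta>. coef_variance \<theta> g l) \<in> borel_measurable (group_R2_hyper G p aG a2)"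
    using g l by (rule borel_measurable_coef_variance)
  have "(\<integral>\<^sup>+\<theta>. indicator {..0} (coef_variance \<theta> g l) \<partial>group_R2_hyper G p aG a2)
      = (\<integral>\<^sup>+x. \<integral>\<^sup>+y. indicator {..0} (x / y) \<partial>gamma_distr a2 \<partial>gamma_distr (aG / real (p g)))"
    using g l by (rule nn_integral_coef_variance) simp
  also have "\<dots> = (\<integral>\<^sup>+x. 0 \<partial>gamma_distr (aG / real (p g)))"
  proof (rule nn_integral_cong_AE, rule AE_mp[OF AE_gamma_distr_pos], rule AE_I2, rule impI)
    fix x :: real assume x: "0 < x"
    have "(\<integral>\<^sup>+y. indicator {..0} (x / y) \<partial>gamma_distr a2) = (\<integral>\<^sup>+y. 0 \<partial>gamma_distr a2)"
      by (rule nn_integral_cong_AE, rule AE_mp[OF AE_gamma_distr_pos])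
         (use x in \<open>auto simp: indicator_def divide_le_0_iff\<close>)
    then show "(\<integral>\<^sup>+y. indicator {..0} (x / y) \<partial>gamma_distr a2) = 0" by simp
  qed
  finally have "AE \<theta> in group_R2_hyper G p aG a2. (indicator {..0} (coef_variance \<theta> g l) :: ennreal) = 0"
    by (subst nn_integral_0_iff_AE[symmetric]) auto
  then show ?thesis by eventually_elim (auto simp: indicator_def split: if_splits)
qed

end

text \<open>In the variable \<open>u\<close>, the precision of the coefficient, the marginal density becomes a
  Laplace transform at \<open>b\<^sup>2 / 2\<close>.\<close>

definition precision_weight :: "real \<Rightarrow> real \<Rightarrow> real \<Rightarrow> real" where
  "precision_weight c a u = pos_powr (a - 1/2) u * (1 + u) powr - (c + a)"

lemma precision_weight_nonneg: "0 \<le> precision_weight c a u"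
  by (simp add: precision_weight_def)

lemma borel_measurable_precision_weight [measurable]: "precision_weight c a \<in> borel_measurable borel"
  unfolding precision_weight_def by measurable

context group_R2
begin

text \<open>A variance \<open>x / y\<close> means precision \<open>u = y / x\<close>. The factor
  \<open>sqrt u\<close> in the normal density shifts the beta prime exponent from
  \<open>a2 - 1\<close> to \<open>a2 - 1/2\<close>.\<close>

lemma nn_integral_coef_density:
  assumes g: "g < G" and l: "l < p g" and c: "c = aG / real (p g)"
  shows "(\<integral>\<^sup>+\<theta>. ennreal (coef_density \<theta> g l b) \<partial>group_R2_hyper G p aG a2)
     = (\<integral>\<^sup>+u. ennreal (1 / (Beta c a2 * sqrt (2 * pi)) * (precision_weight c a2 u * exp (- (b\<^sup>2 / 2 * u)))) \<partial>lborel)"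
proof -
  have c0: "0 < c" using c aG p[OF g] by simp
  have B: "0 < Beta c a2" using c0 a2 by (rule Beta_real_pos)
  have [measurable]: "(\<lambda>v. normal_density 0 (sqrt v) b) \<in> borel_measurable borel"
    unfolding normal_density_def by measurable
  have "(\<integral>\<^sup>+\<theta>. ennreal (coef_density \<theta> g l b) \<partial>group_R2_hyper G p aG a2)
      = (\<integral>\<^sup>+x. \<integral>\<^sup>+y. ennreal (normal_density 0 (sqrt (x / y)) b) \<partial>gamma_distr a2 \<partial>gamma_distr c)"
    unfolding coef_density_def c using g l
    by (intro nn_integral_coef_variance[where H = "\<lambda>v. ennreal (normal_density 0 (sqrt v) b)"]) auto
  also have "\<dots> = (\<integral>\<^sup>+x. \<integral>\<^sup>+y. ennreal (normal_density 0 (sqrt (1 / (y / x))) b) \<partial>gamma_distr a2 \<partial>gamma_distr c)"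
    by simp
  also have "\<dots> = (\<integral>\<^sup>+u. ennreal (pos_powr (a2 - 1) u * (1 + u) powr - (c + a2) / Beta c a2)
      * ennreal (normal_density 0 (sqrt (1 / u)) b) \<partial>lborel)"
    using c0 a2 by (intro nn_integral_gamma_ratio[where H = "\<lambda>u. ennreal (normal_density 0 (sqrt (1 / u)) b)"]) auto
  also have "\<dots> = (\<integral>\<^sup>+u. ennreal (1 / (Beta c a2 * sqrt (2 * pi)) * (precision_weight c a2 u * exp (- (b\<^sup>2 / 2 * u)))) \<partial>lborel)"
  proof (rule nn_integral_cong)
    fix u :: real
    have "pos_powr (a2 - 1) u * (1 + u) powr - (c + a2) / Beta c a2 * normal_density 0 (sqrt (1 / u)) b
        = 1 / (Beta c a2 * sqrt (2 * pi)) * (precision_weight c a2 u * exp (- (b\<^sup>2 / 2 * u)))"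
    proof (cases "0 < u")
      case True
      have "u powr (a2 - 1) * sqrt u = u powr (a2 - 1/2)"
        using True by (simp add: powr_half_sqrt[symmetric] flip: powr_add)
      moreover have "normal_density 0 (sqrt (1 / u)) b = sqrt u / sqrt (2 * pi) * exp (- (b\<^sup>2 / 2 * u))"
        using True by (simp add: normal_density_def real_sqrt_divide real_sqrt_mult field_simps)
      ultimately show ?thesis
        using True B by (simp add: precision_weight_def pos_powr_pos field_simps)
    qed (simp add: precision_weight_def)
    then show "ennreal (pos_powr (a2 - 1) u * (1 + u) powr - (c + a2) / Beta c a2)
      * ennreal (normal_density 0 (sqrt (1 / u)) b)
      = ennreal (1 / (Beta c a2 * sqrt (2 * pi)) * (precision_weight c a2 u * exp (- (b\<^sup>2 / 2 * u))))"
      using B by (simp flip: ennreal_mult')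
  qed
  finally show ?thesis .
qed

text \<open>Valid also where the integrals diverge (\<open>b = 0\<close> with
  \<open>c \<le> 1/2\<close>): both Bochner integrals are \<open>enn2real\<close> of the same
  nonnegative integral and default to 0 together.\<close>

lemma coef_marginal_density_eq:
  assumes g: "g < G" and l: "l < p g" and c: "c = aG / real (p g)"
  shows "coef_marginal_density G p aG a2 g l b
     = 1 / (Beta c a2 * sqrt (2 * pi)) * (\<integral>u. precision_weight c a2 u * exp (- (b\<^sup>2 / 2 * u)) \<partial>lborel)"
proof -
  have "0 < c" using c aG p[OF g] by simp
  then have B: "0 < Beta c a2" using a2 by (rule Beta_real_pos)
  have "coef_marginal_density G p aG a2 g l b
      = enn2real (\<integral>\<^sup>+\<theta>. ennreal (coef_density \<theta> g l b) \<partial>group_R2_hyper G p aG a2)"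
    unfolding coef_marginal_density_def using g l
    by (intro integral_eq_nn_integral AE_I2 coef_density_nonneg) measurable
  also have "\<dots> = (\<integral>u. 1 / (Beta c a2 * sqrt (2 * pi)) * (precision_weight c a2 u * exp (- (b\<^sup>2 / 2 * u))) \<partial>lborel)"
    unfolding nn_integral_coef_density[OF assms] using B
    by (intro integral_eq_nn_integral[symmetric] AE_I2) (auto simp: precision_weight_nonneg)
  finally show ?thesis by simp
qed

text \<open>For \<open>b \<noteq> 0\<close> the exponential has positive rate, so
  \<open>(1 + u) powr - (c + a2)\<close> may be bounded by 1 and a gamma integral remains.\<close>

lemma nn_integral_coef_density_finite:
  assumes g: "g < G" and l: "l < p g" and b: "b \<noteq> 0"
  shows "(\<integral>\<^sup>+\<theta>. ennreal (coef_density \<theta> g l b) \<partial>group_R2_hyper G p aG a2) < \<infinity>"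
proof -
  define c where "c = aG / real (p g)"
  let ?C = "1 / (Beta c a2 * sqrt (2 * pi))"
  have c0: "0 < c" using c_def aG p[OF g] by simp
  have C: "0 \<le> ?C" using Beta_real_pos[OF c0 a2] by simp
  have "(\<integral>\<^sup>+\<theta>. ennreal (coef_density \<theta> g l b) \<partial>group_R2_hyper G p aG a2)
     = (\<integral>\<^sup>+u. ennreal (?C * (precision_weight c a2 u * exp (- (b\<^sup>2 / 2 * u)))) \<partial>lborel)"
    by (rule nn_integral_coef_density[OF g l c_def])
  also have "\<dots> \<le> (\<integral>\<^sup>+u. ennreal ?C * ennreal (pos_powr ((a2 + 1/2) - 1) u * exp (- (b\<^sup>2 / 2 * u))) \<partial>lborel)"
  proof (rule nn_integral_mono)
    fix u :: real
    have "(1 + u) powr - (c + a2) \<le> 1" if "0 < u"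
      using powr_mono[of "- (c + a2)" 0 "1 + u"] that c0 a2 by simp
    then have "precision_weight c a2 u \<le> pos_powr ((a2 + 1/2) - 1) u"
      by (auto simp: precision_weight_def pos_powr_def intro!: mult_left_le)
    then have "?C * (precision_weight c a2 u * exp (- (b\<^sup>2 / 2 * u)))
       \<le> ?C * (pos_powr ((a2 + 1/2) - 1) u * exp (- (b\<^sup>2 / 2 * u)))"
      using C by (intro mult_left_mono mult_right_mono) auto
    then show "ennreal (?C * (precision_weight c a2 u * exp (- (b\<^sup>2 / 2 * u))))
      \<le> ennreal ?C * ennreal (pos_powr ((a2 + 1/2) - 1) u * exp (- (b\<^sup>2 / 2 * u)))"
      unfolding ennreal_mult'[OF C, symmetric] by (rule ennreal_leI)
  qed
  also have "\<dots> < \<infinity>"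
    using a2 b by (subst nn_integral_cmult, measurable, subst nn_integral_pos_powr_exp) (auto simp: ennreal_mult_less_top)
  finally show ?thesis .
qed

text \<open>For fixed hyperparameters the coefficients are integrated coordinate by coordinate;
  every factor other than that of \<open>(g, l)\<close> gives 1 once all variances are positive.
  Fubini then moves the average over the hyperparameters inside.\<close>

lemma distributed_coef:
  assumes g: "g < G" and l: "l < p g"
  shows "distributed (group_R2_prior G p aG a2) lborel (\<lambda>(\<theta>, b). b (g, l))
           (\<lambda>x. ennreal (coef_marginal_density G p aG a2 g l x))"
proof -
  let ?M = "group_R2_hyper G p aG a2" and ?I = "coef_indices G p"
  let ?L = "\<Pi>\<^sub>M i\<in>?I. (lborel :: real measure)"
  interpret P: product_sigma_finite "\<lambda>_ :: nat \<times> nat. lborel :: real measure" ..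
  have fin: "finite ?I" by (simp add: coef_indices_def)
  interpret L: sigma_finite_measure "?L" using fin by (rule P.sigma_finite)
  interpret HL: pair_sigma_finite "?M" lborel ..
  have gl: "(g, l) \<in> ?I" using g l by (simp add: coef_indices_def)
  have ind: "fst i < G" "snd i < p (fst i)" if "i \<in> ?I" for i
    using that by (auto simp: coef_indices_def)
  have [measurable]: "(\<lambda>z. coef_density (fst z) g l (snd z)) \<in> borel_measurable (?M \<Otimes>\<^sub>M lborel)"
    by (rule borel_measurable_coef_density) (use g l in auto)
  have [measurable]: "coef_density \<theta> h m \<in> borel_measurable borel" for \<theta> h m
    unfolding coef_density_def[abs_def] normal_density_def by measurable
  have joint: "(\<lambda>z. coef_density (fst z) (fst i) (snd i) (snd z (fst i, snd i))) \<in> borel_measurable (?M \<Otimes>\<^sub>M ?L)"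
    if i: "i \<in> ?I" for i
  proof (rule borel_measurable_coef_density[where G = G and p = p and \<alpha> = aG and \<beta> = a2 and \<theta> = fst, OF ind[OF i]])
    show "fst \<in> ?M \<Otimes>\<^sub>M ?L \<rightarrow>\<^sub>M ?M" by (rule measurable_fst)
    show "(\<lambda>z. snd z (fst i, snd i)) \<in> borel_measurable (?M \<Otimes>\<^sub>M ?L)"
      using measurable_compose[OF measurable_snd[of ?M ?L] measurable_component_singleton[OF i, of "\<lambda>_. lborel"]] by simp
  qed
  define D where "D z = ennreal (\<Prod>i\<in>?I. coef_density (fst z) (fst i) (snd i) (snd z i))"
    for z :: "hyper \<times> (nat \<times> nat \<Rightarrow> real)"
  have D: "D \<in> borel_measurable (?M \<Otimes>\<^sub>M ?L)"
    unfolding D_def using joint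
    by (intro measurable_compose[OF borel_measurable_prod measurable_ennreal]) simp
  have prior: "group_R2_prior G p aG a2 = density (?M \<Otimes>\<^sub>M ?L) D"
    by (simp add: group_R2_prior_def D_def[abs_def] case_prod_unfold)
  have X' [measurable]: "(\<lambda>z. snd z (g, l)) \<in> borel_measurable (?M \<Otimes>\<^sub>M ?L)"
    using measurable_compose[OF measurable_snd[of ?M ?L] measurable_component_singleton[OF gl, of "\<lambda>_. lborel"]]
    by simp
  have X: "(\<lambda>(\<theta>, b). b (g, l)) \<in> borel_measurable (?M \<Otimes>\<^sub>M ?L)"
    using X' by (simp only: case_prod_unfold)
  have f [measurable]: "coef_marginal_density G p aG a2 g l \<in> borel_measurable borel"
    unfolding coef_marginal_density_eq[OF g l refl, abs_def] by measurable
  have norm1: "(\<integral>\<^sup>+x. ennreal (coef_density \<theta> h m x) \<partial>lborel) = 1" if "0 < coef_variance \<theta> h m" for \<theta> h m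
    using prob_space.emeasure_space_1[OF prob_space_normal_density[of "sqrt (coef_variance \<theta> h m)" 0]] that
    by (simp add: emeasure_density coef_density_def)
  have pos: "AE \<theta> in ?M. \<forall>i\<in>?I. 0 < coef_variance \<theta> (fst i) (snd i)"
    using AE_coef_variance_pos ind fin by (intro AE_finite_allI) auto
  have sp: "sets (group_R2_prior G p aG a2) = sets (?M \<Otimes>\<^sub>M ?L)" "space (group_R2_prior G p aG a2) = space (?M \<Otimes>\<^sub>M ?L)"
    by (simp_all add: group_R2_prior_def)
  have PX: "(\<lambda>(\<theta>, b). b (g, l)) \<in> group_R2_prior G p aG a2 \<rightarrow>\<^sub>M lborel"
    unfolding measurable_cong_sets[OF sp(1) sets_lborel] by (rule X)
  have "distr (group_R2_prior G p aG a2) lborel (\<lambda>(\<theta>, b). b (g, l))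
      = density lborel (\<lambda>x. ennreal (coef_marginal_density G p aG a2 g l x))"
  proof (rule measure_eqI)
    fix A assume "A \<in> sets (distr (group_R2_prior G p aG a2) lborel (\<lambda>(\<theta>, b). b (g, l)))"
    then have A [measurable]: "A \<in> sets borel" by simp
    \<comment> \<open>The indicator of \<open>A\<close> is placed in the factor of
      \<open>(g, l)\<close>, so that the integrand becomes a product over the coordinates.\<close>
    define h where "h \<theta> i x = ennreal (coef_density \<theta> (fst i) (snd i) x)
        * (if i = (g, l) then indicator A x else 1)" for \<theta> i x
    have [measurable]: "h \<theta> i \<in> borel_measurable borel" for \<theta> i
      unfolding h_def[abs_def] by measurable
    have indA: "(\<lambda>z. indicator A (snd z (g, l)) :: ennreal) \<in> borel_measurable (?M \<Otimes>\<^sub>M ?L)"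
      using measurable_compose[OF X' borel_measurable_indicator[OF A]] .
    have "emeasure (distr (group_R2_prior G p aG a2) lborel (\<lambda>(\<theta>, b). b (g, l))) A
       = (\<integral>\<^sup>+x. indicator A x \<partial>distr (group_R2_prior G p aG a2) lborel (\<lambda>(\<theta>, b). b (g, l)))"
      using A by (subst nn_integral_indicator) auto
    also have "\<dots> = (\<integral>\<^sup>+z. indicator A (case z of (\<theta>, b) \<Rightarrow> b (g, l)) \<partial>group_R2_prior G p aG a2)"
      by (rule nn_integral_distr[OF PX]) (use A in simp)
    also have "\<dots> = (\<integral>\<^sup>+z. indicator A (snd z (g, l)) \<partial>group_R2_prior G p aG a2)"
      by (simp add: case_prod_beta)
    also have "\<dots> = (\<integral>\<^sup>+z. D z * indicator A (snd z (g, l)) \<partial>(?M \<Otimes>\<^sub>M ?L))"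
      unfolding prior by (rule nn_integral_density[OF D indA])
    also have "\<dots> = (\<integral>\<^sup>+\<theta>. \<integral>\<^sup>+b. ennreal (\<Prod>i\<in>?I. coef_density \<theta> (fst i) (snd i) (b i))
         * indicator A (b (g, l)) \<partial>?L \<partial>?M)"
      using L.nn_integral_fst[OF borel_measurable_times_ennreal[OF D indA]] by (simp add: D_def)
    also have "\<dots> = (\<integral>\<^sup>+\<theta>. \<integral>\<^sup>+b. (\<Prod>i\<in>?I. h \<theta> i (b i)) \<partial>?L \<partial>?M)"
    proof (intro nn_integral_cong)
      fix \<theta> and b :: "nat \<times> nat \<Rightarrow> real"
      have "(\<Prod>i\<in>?I. (if i = (g, l) then indicator A (b i) else 1)) = (indicator A (b (g, l)) :: ennreal)"
        using fin gl by (subst prod.delta) auto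
      then show "ennreal (\<Prod>i\<in>?I. coef_density \<theta> (fst i) (snd i) (b i)) * indicator A (b (g, l)) = (\<Prod>i\<in>?I. h \<theta> i (b i))"
        by (simp add: h_def prod.distrib prod_ennreal coef_density_nonneg)
    qed
    also have "\<dots> = (\<integral>\<^sup>+\<theta>. (\<Prod>i\<in>?I. \<integral>\<^sup>+x. h \<theta> i x \<partial>lborel) \<partial>?M)"
      using fin by (intro nn_integral_cong P.product_nn_integral_prod) auto
    also have "\<dots> = (\<integral>\<^sup>+\<theta>. \<integral>\<^sup>+x. ennreal (coef_density \<theta> g l x) * indicator A x \<partial>lborel \<partial>?M)"
    proof (rule nn_integral_cong_AE, rule AE_mp[OF pos], rule AE_I2, rule impI)
      fix \<theta> assume \<theta>: "\<forall>i\<in>?I. 0 < coef_variance \<theta> (fst i) (snd i)"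
      have "(\<Prod>i\<in>?I. \<integral>\<^sup>+x. h \<theta> i x \<partial>lborel)
          = (\<Prod>i\<in>?I. if i = (g, l) then \<integral>\<^sup>+x. ennreal (coef_density \<theta> g l x) * indicator A x \<partial>lborel else 1)"
        using \<theta> by (intro prod.cong) (auto simp: h_def norm1)
      then show "(\<Prod>i\<in>?I. \<integral>\<^sup>+x. h \<theta> i x \<partial>lborel) = (\<integral>\<^sup>+x. ennreal (coef_density \<theta> g l x) * indicator A x \<partial>lborel)"
        using fin gl by (simp add: prod.delta)
    qed
    also have "\<dots> = (\<integral>\<^sup>+x. \<integral>\<^sup>+\<theta>. ennreal (coef_density \<theta> g l x) * indicator A x \<partial>?M \<partial>lborel)"
      by (rule HL.Fubini'[symmetric]) (simp add: case_prod_beta)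
    also have "\<dots> = (\<integral>\<^sup>+x. (\<integral>\<^sup>+\<theta>. ennreal (coef_density \<theta> g l x) \<partial>?M) * indicator A x \<partial>lborel)"
      using g l by (intro nn_integral_cong nn_integral_multc) measurable
    also have "\<dots> = (\<integral>\<^sup>+x. ennreal (coef_marginal_density G p aG a2 g l x) * indicator A x \<partial>lborel)"
    \<comment> \<open>At 0 the nonnegative integral may be infinite while the Bochner integral
      returns 0; this single point is discarded.\<close>
    proof (rule nn_integral_cong_AE, rule AE_mp[OF AE_lborel_singleton[of 0]], rule AE_I2, rule impI)
      fix x :: real assume "x \<noteq> 0"
      then have fin: "(\<integral>\<^sup>+\<theta>. ennreal (coef_density \<theta> g l x) \<partial>?M) < \<infinity>"
        by (rule nn_integral_coef_density_finite[OF g l])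
      have "coef_marginal_density G p aG a2 g l x = enn2real (\<integral>\<^sup>+\<theta>. ennreal (coef_density \<theta> g l x) \<partial>?M)"
        unfolding coef_marginal_density_def using g l
        by (intro integral_eq_nn_integral AE_I2 coef_density_nonneg) measurable
      then show "(\<integral>\<^sup>+\<theta>. ennreal (coef_density \<theta> g l x) \<partial>?M) * indicator A x
          = ennreal (coef_marginal_density G p aG a2 g l x) * indicator A x"
        using fin by simp
    qed
    also have "\<dots> = emeasure (density lborel (\<lambda>x. ennreal (coef_marginal_density G p aG a2 g l x))) A"
      by (subst emeasure_density) auto
    finally show "emeasure (distr (group_R2_prior G p aG a2) lborel (\<lambda>(\<theta>, b). b (g, l))) A
        = emeasure (density lborel (\<lambda>x. ennreal (coef_marginal_density G p aG a2 g l x))) A" .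
  qed simp
  then show ?thesis
    unfolding distributed_def using PX by simp
qed

end

section \<open>Laplace transforms at small arguments\<close>

lemma has_bochner_integral_pos_powr_exp:
  assumes "0 < a" "0 < s"
  shows "has_bochner_integral lborel (\<lambda>u. pos_powr (a - 1) u * exp (- (s * u))) (Gamma a * s powr - a)"
  using assms by (intro has_bochner_integral_nn_integral nn_integral_pos_powr_exp)
    (auto simp: Gamma_real_pos less_imp_le)

text \<open>Turns the factor \<open>1 - exp (- (s * u))\<close> into an integral, ready for Fubini.
  The interval is open at 0 so that the swapped integral over \<open>u \<ge> x\<close> occurs only
  for \<open>x > 0\<close>, where it is finite.\<close>

lemma nn_integral_exp_Icc:
  assumes "0 \<le> u" "0 < s"
  shows "(\<integral>\<^sup>+x. ennreal (s * exp (- (s * x))) * indicator {0<..u} x \<partial>lborel) = ennreal (1 - exp (- (s * u)))"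
proof -
  have "(\<integral>\<^sup>+x. ennreal (s * exp (- (s * x))) * indicator {0<..u} x \<partial>lborel)
      = (\<integral>\<^sup>+x. ennreal (s * exp (- (s * x))) * indicator {0..u} x \<partial>lborel)"
    by (rule nn_integral_cong_AE, rule AE_mp[OF AE_lborel_singleton[of 0]]) (auto simp: indicator_def)
  also have "\<dots> = ennreal (- exp (- (s * u)) - - exp (- (s * 0)))"
    using assms by (intro nn_integral_FTC_Icc) (auto intro!: derivative_eq_intros)
  finally show ?thesis by simp
qed

lemma nn_integral_pos_powr_atLeast:
  assumes "0 < x" "0 < q"
  shows "(\<integral>\<^sup>+u. ennreal (pos_powr (- 1 - q) u) * indicator {x..} u \<partial>lborel) = ennreal (x powr - q / q)"
proof -
  have "(\<integral>\<^sup>+u. ennreal (pos_powr (- 1 - q) u) * indicator {x..} u \<partial>lborel) = ennreal (0 - (- (x powr - q) / q))"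
  proof (rule nn_integral_FTC_atLeast)
    fix u assume "x \<le> u"
    then have u: "0 < u" using assms by simp
    show "((\<lambda>u. - (u powr - q) / q) has_real_derivative pos_powr (- 1 - q) u) (at u)"
      using u assms by (auto intro!: derivative_eq_intros simp: pos_powr_pos minus_diff_commute[of 1 q])
  next
    have "((\<lambda>u. u powr - q) \<longlongrightarrow> 0) at_top"
      using assms tendsto_neg_powr[OF _ filterlim_ident] by simp
    then have "((\<lambda>u. - (u powr - q) / q) \<longlongrightarrow> - 0 / q) at_top"
      using assms by (intro tendsto_intros) auto
    then show "((\<lambda>u. - (u powr - q) / q) \<longlongrightarrow> 0) at_top" by simp
  qed auto
  then show ?thesis by simp
qed

text \<open>After Fubini the integral over \<open>u \<ge> x\<close> is
  \<open>x powr - q / q\<close>, which needs \<open>q > 0\<close>; the remaining gamma integral has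
  shape \<open>1 - q\<close>, which needs \<open>q < 1\<close>. At \<open>s = 0\<close> both sides
  vanish, as \<open>0 powr q = 0\<close>.\<close>

lemma has_bochner_integral_pos_powr_one_minus_exp:
  assumes q: "0 < q" "q < 1" and s: "0 \<le> s"
  shows "has_bochner_integral lborel (\<lambda>u. pos_powr (- 1 - q) u * (1 - exp (- (s * u)))) (Gamma (1 - q) / q * s powr q)"
proof (cases "s = 0")
  case True
  then show ?thesis using has_bochner_integral_zero[of lborel] by simp
next
  case False
  then have s: "0 < s" using s by simp
  let ?k = "\<lambda>u x. ennreal (pos_powr (- 1 - q) u) * (ennreal (s * exp (- (s * x))) * indicator {0<..u} x)"
  show ?thesis
  proof (rule has_bochner_integral_nn_integral)
    have "(\<integral>\<^sup>+u. ennreal (pos_powr (- 1 - q) u * (1 - exp (- (s * u)))) \<partial>lborel) = (\<integral>\<^sup>+u. \<integral>\<^sup>+x. ?k u x \<partial>lborel \<partial>lborel)"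
    proof (rule nn_integral_cong)
      fix u :: real
      show "ennreal (pos_powr (- 1 - q) u * (1 - exp (- (s * u)))) = (\<integral>\<^sup>+x. ?k u x \<partial>lborel)"
      proof (cases "0 \<le> u")
        case True
        then show ?thesis using s
          by (subst nn_integral_cmult, measurable, subst nn_integral_exp_Icc) (simp_all add: ennreal_mult')
      qed simp
    qed
    also have "\<dots> = (\<integral>\<^sup>+x. \<integral>\<^sup>+u. ?k u x \<partial>lborel \<partial>lborel)"
    proof (rule lborel_pair.Fubini')
      have [measurable]: "Measurable.pred (borel \<Otimes>\<^sub>M borel) (\<lambda>z :: real \<times> real. fst z \<in> {0<..snd z})"
        "Measurable.pred (borel \<Otimes>\<^sub>M borel) (\<lambda>z :: real \<times> real. snd z \<in> {0<..fst z})"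
        unfolding greaterThanAtMost_iff by measurable
      show "(\<lambda>(x, u). ?k u x) \<in> borel_measurable (lborel \<Otimes>\<^sub>M lborel)" by measurable
    qed
    also have "\<dots> = (\<integral>\<^sup>+x. ennreal (s / q) * ennreal (pos_powr ((1 - q) - 1) x * exp (- (s * x))) \<partial>lborel)"
    proof (rule nn_integral_cong)
      fix x :: real
      show "(\<integral>\<^sup>+u. ?k u x \<partial>lborel) = ennreal (s / q) * ennreal (pos_powr ((1 - q) - 1) x * exp (- (s * x)))"
      proof (cases "0 < x")
        case True
        have "(\<integral>\<^sup>+u. ?k u x \<partial>lborel)
            = (\<integral>\<^sup>+u. ennreal (s * exp (- (s * x))) * (ennreal (pos_powr (- 1 - q) u) * indicator {x..} u) \<partial>lborel)"
          using True by (intro nn_integral_cong) (auto simp: indicator_def mult_ac)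
        also have "\<dots> = ennreal (s * exp (- (s * x))) * ennreal (x powr - q / q)"
          using True q by (subst nn_integral_cmult, measurable, subst nn_integral_pos_powr_atLeast) auto
        also have "\<dots> = ennreal (s / q) * ennreal (pos_powr ((1 - q) - 1) x * exp (- (s * x)))"
          using True s q by (simp add: pos_powr_pos mult_ac flip: ennreal_mult')
        finally show ?thesis .
      next
        case False
        then have "?k u x = 0" for u by (auto simp: indicator_def)
        then show ?thesis using False by simp
      qed
    qed
    also have "\<dots> = ennreal (s / q) * ennreal (Gamma (1 - q) * s powr - (1 - q))"
      using q s by (subst nn_integral_cmult, measurable, subst nn_integral_pos_powr_exp) auto
    also have "\<dots> = ennreal (Gamma (1 - q) / q * s powr q)"
      using q s by (simp add: powr_diff field_simps powr_minus flip: ennreal_mult')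
    finally show "(\<integral>\<^sup>+u. ennreal (pos_powr (- 1 - q) u * (1 - exp (- (s * u)))) \<partial>lborel)
        = ennreal (Gamma (1 - q) / q * s powr q)" .
    show "AE u in lborel. 0 \<le> pos_powr (- 1 - q) u * (1 - exp (- (s * u)))"
    proof (rule AE_I2)
      fix u :: real
      show "0 \<le> pos_powr (- 1 - q) u * (1 - exp (- (s * u)))"
        using s by (cases "0 < u") (auto simp: pos_powr_nonneg)
    qed
    show "0 \<le> Gamma (1 - q) / q * s powr q"
      using q by (simp add: Gamma_real_pos less_imp_le)
  qed measurable
qed

section \<open>Functions dominated by a power tail\<close>

context
  fixes h :: "real \<Rightarrow> real" and B q :: real
  assumes h [measurable]: "h \<in> borel_measurable borel" and q: "0 < q" "q < 1"
    and tail: "\<And>u. \<bar>h u\<bar> \<le> B * pos_powr (- 1 - q) u"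
begin

lemma abs_mult_one_minus_exp_le:
  assumes "0 \<le> s"
  shows "\<bar>h u * (1 - exp (- (s * u)))\<bar> \<le> B * (pos_powr (- 1 - q) u * (1 - exp (- (s * u))))"
proof (cases "0 < u")
  case True
  then show ?thesis using mult_right_mono[OF tail[of u], of "1 - exp (- (s * u))"] assms
    by (simp add: abs_mult mult_ac)
next
  case False
  then show ?thesis using tail[of u] by simp
qed

lemma integrable_mult_one_minus_exp:
  assumes "0 \<le> s"
  shows "integrable lborel (\<lambda>u. h u * (1 - exp (- (s * u))))"
proof (rule Bochner_Integration.integrable_bound)
  show "integrable lborel (\<lambda>u. B * (pos_powr (- 1 - q) u * (1 - exp (- (s * u)))))"
    using has_bochner_integral_pos_powr_one_minus_exp[OF q assms]
    by (intro integrable_mult_right) (auto simp: has_bochner_integral_iff)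
  show "AE u in lborel. norm (h u * (1 - exp (- (s * u)))) \<le> norm (B * (pos_powr (- 1 - q) u * (1 - exp (- (s * u)))))"
  proof (rule AE_I2)
    fix u
    show "norm (h u * (1 - exp (- (s * u)))) \<le> norm (B * (pos_powr (- 1 - q) u * (1 - exp (- (s * u)))))"
      using abs_mult_one_minus_exp_le[OF assms, of u] by simp
  qed
qed measurable

lemma abs_integral_mult_one_minus_exp_le:
  assumes "0 \<le> s"
  shows "\<bar>\<integral>u. h u * (1 - exp (- (s * u))) \<partial>lborel\<bar> \<le> B * (Gamma (1 - q) / q * s powr q)"
proof -
  have "\<bar>\<integral>u. h u * (1 - exp (- (s * u))) \<partial>lborel\<bar> \<le> (\<integral>u. \<bar>h u * (1 - exp (- (s * u)))\<bar> \<partial>lborel)"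
    by (rule integral_abs_bound)
  also have "\<dots> \<le> (\<integral>u. B * (pos_powr (- 1 - q) u * (1 - exp (- (s * u)))) \<partial>lborel)"
    using has_bochner_integral_pos_powr_one_minus_exp[OF q assms]
    by (intro integral_mono integrable_abs integrable_mult_one_minus_exp abs_mult_one_minus_exp_le assms integrable_mult_right)
       (auto simp: has_bochner_integral_iff)
  also have "\<dots> = B * (Gamma (1 - q) / q * s powr q)"
    using has_bochner_integral_pos_powr_one_minus_exp[OF q assms] by (simp add: has_bochner_integral_iff)
  finally show ?thesis .
qed

text \<open>Writing \<open>h u\<close> as \<open>h u * exp (- u) + h u * (1 - exp (- u))\<close> uses each bound only where it is
  integrable.\<close>

lemma integrable_if_pos_powr_bounds:
  assumes \<gamma>: "0 < \<gamma>" and head: "\<And>u. \<bar>h u\<bar> \<le> A * pos_powr (\<gamma> - 1) u"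
  shows "integrable lborel h"
proof -
  have "integrable lborel (\<lambda>u. h u * exp (- (1 * u)))"
  proof (rule Bochner_Integration.integrable_bound)
    show "integrable lborel (\<lambda>u. A * (pos_powr (\<gamma> - 1) u * exp (- (1 * u))))"
      using has_bochner_integral_pos_powr_exp[OF \<gamma> zero_less_one]
      by (intro integrable_mult_right) (auto simp: has_bochner_integral_iff)
    show "AE u in lborel. norm (h u * exp (- (1 * u))) \<le> norm (A * (pos_powr (\<gamma> - 1) u * exp (- (1 * u))))"
    proof (rule AE_I2)
      fix u
      have "norm (h u * exp (- (1 * u))) = \<bar>h u\<bar> * exp (- u)"
        by (simp add: abs_mult)
      also have "\<dots> \<le> A * pos_powr (\<gamma> - 1) u * exp (- u)"
        using head[of u] by (rule mult_right_mono) simp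
      also have "\<dots> \<le> norm (A * (pos_powr (\<gamma> - 1) u * exp (- (1 * u))))"
        unfolding real_norm_def mult.assoc mult_1 by (rule abs_ge_self)
      finally show "norm (h u * exp (- (1 * u))) \<le> norm (A * (pos_powr (\<gamma> - 1) u * exp (- (1 * u))))" .
    qed
  qed measurable
  from Bochner_Integration.integrable_add[OF this integrable_mult_one_minus_exp[OF zero_le_one]]
  show ?thesis by (simp add: algebra_simps)
qed

text \<open>Splitting off the integral of \<open>h\<close> produces the constant term of an
  expansion; the rest is of order \<open>s powr q\<close> by
  \<open>abs_integral_mult_one_minus_exp_le\<close>.\<close>

lemma integral_mult_exp_eq:
  assumes h1: "integrable lborel h" and s: "0 \<le> s"
  shows "integrable lborel (\<lambda>u. h u * exp (- (s * u)))"
    and "(\<integral>u. h u * exp (- (s * u)) \<partial>lborel) = (\<integral>u. h u \<partial>lborel) - (\<integral>u. h u * (1 - exp (- (s * u))) \<partial>lborel)"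
proof -
  have eq: "h u * exp (- (s * u)) = h u - h u * (1 - exp (- (s * u)))" for u by (simp add: algebra_simps)
  show "integrable lborel (\<lambda>u. h u * exp (- (s * u)))"
    unfolding eq using h1 integrable_mult_one_minus_exp[OF s] by (rule Bochner_Integration.integrable_diff)
  show "(\<integral>u. h u * exp (- (s * u)) \<partial>lborel) = (\<integral>u. h u \<partial>lborel) - (\<integral>u. h u * (1 - exp (- (s * u))) \<partial>lborel)"
    unfolding eq using h1 integrable_mult_one_minus_exp[OF s] by (subst Bochner_Integration.integral_diff) auto
qed

end

text \<open>The factor \<open>(1 + u) powr - (c + a)\<close> is weakened first in the exponent, then
  in the base. The choice \<open>e = 0\<close> gives the bound near 0, \<open>e = c + a\<close> the
  full tail, and values in between give slower tails that respect the restriction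
  \<open>q < 1\<close>.\<close>

lemma precision_weight_le_pos_powr:
  assumes "0 \<le> e" "e \<le> c + a"
  shows "precision_weight c a u \<le> pos_powr (a - 1/2 - e) u"
proof (cases "0 < u")
  case True
  have "(1 + u) powr - (c + a) \<le> (1 + u) powr - e"
    using True assms by (intro powr_mono) auto
  also have "\<dots> \<le> u powr - e"
    using True assms by (intro powr_mono2') auto
  finally have "u powr (a - 1/2) * (1 + u) powr - (c + a) \<le> u powr (a - 1/2) * u powr - e"
    by (rule mult_left_mono) simp
  then show ?thesis using True by (simp add: precision_weight_def pos_powr_pos flip: powr_add)
qed (simp add: precision_weight_def)

text \<open>For \<open>t = u / (1 + u)\<close>, the inequality \<open>1 + x \<le> exp x\<close>
  gives \<open>1 - t powr m \<le> - m * ln t\<close>, and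
  \<open>- ln t = ln (1 + 1 / u) \<le> 1 / u\<close>.\<close>

lemma one_minus_powr_le:
  fixes u m :: real
  assumes "0 < u" "0 < m"
  shows "1 - (u / (1 + u)) powr m \<le> m / u"
proof -
  have "- ln (u / (1 + u)) = ln (1 + 1 / u)"
  proof -
    have "1 + 1 / u = (1 + u) / u" using assms by (simp add: add_divide_distrib)
    then show ?thesis using assms by (simp add: ln_div)
  qed
  also have "\<dots> \<le> 1 / u" using assms by (intro ln_add_one_self_le_self) simp
  finally have "- (m / u) \<le> m * ln (u / (1 + u))"
    using assms mult_left_mono[of "- ln (u / (1 + u))" "1 / u" m] by simp
  also have "1 + m * ln (u / (1 + u)) \<le> (u / (1 + u)) powr m"
    using assms exp_ge_add_one_self[of "m * ln (u / (1 + u))"] by (simp add: powr_def)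
  finally show ?thesis by simp
qed

section \<open>The precision weight against its power tail\<close>

context
  fixes c a :: real assumes c: "0 < c" and a: "0 < a"
begin

lemma precision_weight_factor: "precision_weight c a u = pos_powr (- c - 1/2) u * (u / (1 + u)) powr (c + a)"
proof (cases "0 < u")
  case True
  have "u powr (a - 1/2) = u powr (- c - 1/2) * u powr (c + a)"
    by (simp flip: powr_add)
  moreover have "(u / (1 + u)) powr m = u powr m * (1 + u) powr - m" for m
    using True by (simp add: powr_divide powr_minus_divide)
  ultimately show ?thesis using True
    unfolding precision_weight_def by (simp only: pos_powr_pos mult.assoc)
qed (simp add: precision_weight_def)

text \<open>The two upper bounds have different uses: the tail itself controls the deficit near 0,
  the bound with one more power of decay controls it at infinity. The latter is
  \<open>one_minus_powr_le\<close> applied to the factor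
  \<open>(u / (1 + u)) powr (c + a)\<close>.\<close>

lemma precision_weight_deficit:
  "0 \<le> pos_powr (- c - 1/2) u - precision_weight c a u"
  "pos_powr (- c - 1/2) u - precision_weight c a u \<le> pos_powr (- c - 1/2) u"
  "pos_powr (- c - 1/2) u - precision_weight c a u \<le> (c + a) * pos_powr (- c - 3/2) u"
proof -
  show "pos_powr (- c - 1/2) u - precision_weight c a u \<le> pos_powr (- c - 1/2) u"
    using precision_weight_nonneg[of c a u] by simp
  show "0 \<le> pos_powr (- c - 1/2) u - precision_weight c a u"
    using precision_weight_le_pos_powr[of "c + a" c a u] c a by (simp add: algebra_simps)
  show "pos_powr (- c - 1/2) u - precision_weight c a u \<le> (c + a) * pos_powr (- c - 3/2) u"
  proof (cases "0 < u")
    case True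
    have "pos_powr (- c - 1/2) u - precision_weight c a u = pos_powr (- c - 1/2) u * (1 - (u / (1 + u)) powr (c + a))"
      by (simp add: precision_weight_factor algebra_simps)
    also have "\<dots> \<le> pos_powr (- c - 1/2) u * ((c + a) / u)"
      using True c a by (intro mult_left_mono one_minus_powr_le) auto
    also have "\<dots> = (c + a) * (pos_powr (- c - 1/2) u * pos_powr (- 1) u)"
      using True by (simp add: pos_powr_pos powr_minus divide_simps)
    also have "pos_powr (- c - 1/2) u * pos_powr (- 1) u = pos_powr (- c - 3/2) u"
      unfolding pos_powr_mult_pos_powr by (rule arg_cong[where f = "\<lambda>e. pos_powr e u"]) simp
    finally show ?thesis .
  qed (simp add: precision_weight_def)
qed

text \<open>Allowing \<open>q\<close> below the true decay rate \<open>c - 1/2\<close> keeps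
  \<open>q < 1\<close> available when \<open>c\<close> is large.\<close>

lemma abs_precision_weight_le_tail:
  assumes "0 < q" "q \<le> c - 1/2"
  shows "\<bar>precision_weight c a u\<bar> \<le> 1 * pos_powr (- 1 - q) u"
  using precision_weight_le_pos_powr[of "a + 1/2 + q" c a u] assms a precision_weight_nonneg[of c a u]
  by (simp add: algebra_simps)

lemma abs_precision_weight_le_head: "\<bar>precision_weight c a u\<bar> \<le> 1 * pos_powr ((a + 1/2) - 1) u"
  using precision_weight_le_pos_powr[of 0 c a u] c a precision_weight_nonneg[of c a u]
  by (simp add: algebra_simps)

lemma integrable_precision_weight: "1/2 < c \<Longrightarrow> integrable lborel (precision_weight c a)"
  using a by (intro integrable_if_pos_powr_bounds[of _ "min (1/2) (c - 1/2)" 1 "a + 1/2" 1]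
      abs_precision_weight_le_tail abs_precision_weight_le_head) auto

lemma laplace_precision_weight_continuity:
  assumes q: "0 < q" "q < 1" "q \<le> c - 1/2" and s: "0 \<le> s"
  shows "\<bar>(\<integral>u. precision_weight c a u * exp (- (s * u)) \<partial>lborel) - (\<integral>u. precision_weight c a u \<partial>lborel)\<bar>
     \<le> Gamma (1 - q) / q * s powr q"
proof -
  note tail = abs_precision_weight_le_tail[OF q(1,3)]
  have "integrable lborel (precision_weight c a)" using q by (intro integrable_precision_weight) auto
  from integral_mult_exp_eq(2)[OF borel_measurable_precision_weight q(1,2) tail this s]
    abs_integral_mult_one_minus_exp_le[OF borel_measurable_precision_weight q(1,2) tail s]
  show ?thesis by simp
qed

text \<open>The tail \<open>u powr (- 3/2)\<close> is not integrable at 0, so it is compared with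
  the weight only under the factor \<open>1 - exp (- (s * u))\<close>. There it contributes exactly
  \<open>Gamma (1 - 1/2) / (1/2) * s powr (1/2)\<close>. The remainder's exponent 3/4 lies between
  1/2, the exponent of this term, and the excluded value 1.\<close>

lemma laplace_precision_weight_one:
  assumes c1: "c = 1" and s: "0 \<le> s"
  shows "\<bar>(\<integral>u. precision_weight c a u * exp (- (s * u)) \<partial>lborel) - (\<integral>u. precision_weight c a u \<partial>lborel)
       + 2 * Gamma (1/2) * s powr (1/2)\<bar> \<le> (1 + a) * (Gamma (1/4) / (3/4) * s powr (3/4))"
proof -
  define h where "h u = pos_powr (- c - 1/2) u - precision_weight c a u" for u
  have [measurable]: "h \<in> borel_measurable borel" unfolding h_def by measurable
  \<comment> \<open>The deficit is bounded by \<open>u powr (- 3/2)\<close> up to 1 and by a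
    multiple of \<open>u powr (- 5/2)\<close> beyond; \<open>u powr (- 7/4)\<close> dominates each
    power on its range.\<close>
  have tail: "\<bar>h u\<bar> \<le> (1 + a) * pos_powr (- 1 - 3/4) u" for u
  proof (cases "0 < u")
    case True
    have "h u \<le> (1 + a) * u powr (- 1 - 3/4)"
    proof (cases "u \<le> 1")
      case True
      have "h u \<le> u powr (- 1 - 1/2)"
        using precision_weight_deficit(2)[of u] \<open>0 < u\<close> by (simp add: h_def c1 pos_powr_pos)
      also have "\<dots> \<le> u powr (- 1 - 3/4)" using True \<open>0 < u\<close> by (intro powr_mono') auto
      also have "\<dots> \<le> (1 + a) * u powr (- 1 - 3/4)" using a by (simp add: algebra_simps)
      finally show ?thesis .
    next
      case False
      have "h u \<le> (1 + a) * u powr (- 1 - 3/2)"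
        using precision_weight_deficit(3)[of u] \<open>0 < u\<close> by (simp add: h_def c1 pos_powr_pos)
      also have "\<dots> \<le> (1 + a) * u powr (- 1 - 3/4)" using False a by (intro mult_left_mono powr_mono) auto
      finally show ?thesis .
    qed
    then show ?thesis using True precision_weight_deficit(1)[of u] by (simp add: h_def pos_powr_pos)
  qed (simp add: h_def precision_weight_def)
  have q: "0 < (3/4 :: real)" "3/4 < (1 :: real)" by auto
  have main: "has_bochner_integral lborel (\<lambda>u. pos_powr (- 1 - 1/2) u * (1 - exp (- (s * u))))
      (Gamma (1 - 1/2) / (1/2) * s powr (1/2))"
    using s by (intro has_bochner_integral_pos_powr_one_minus_exp) auto
  have int: "integrable lborel (\<lambda>u. h u * (1 - exp (- (s * u))))"
    by (rule integrable_mult_one_minus_exp[OF _ q tail s]) measurable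
  have w: "integrable lborel (precision_weight c a)"
    using c1 by (intro integrable_precision_weight) auto
  have "(\<integral>u. precision_weight c a u * exp (- (s * u)) \<partial>lborel)
     = (\<integral>u. precision_weight c a u \<partial>lborel) - (\<integral>u. precision_weight c a u * (1 - exp (- (s * u))) \<partial>lborel)"
    using c1 by (intro integral_mult_exp_eq(2)[OF borel_measurable_precision_weight _ _ abs_precision_weight_le_tail[of "1/2"] w s]) auto
  also have "(\<integral>u. precision_weight c a u * (1 - exp (- (s * u))) \<partial>lborel)
     = (\<integral>u. pos_powr (- 1 - 1/2) u * (1 - exp (- (s * u))) - h u * (1 - exp (- (s * u))) \<partial>lborel)"
    by (simp add: h_def c1 algebra_simps)
  also have "\<dots> = Gamma (1 - 1/2) / (1/2) * s powr (1/2) - (\<integral>u. h u * (1 - exp (- (s * u))) \<partial>lborel)"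
    using main int by (subst Bochner_Integration.integral_diff) (auto simp: has_bochner_integral_iff)
  finally show ?thesis
    using abs_integral_mult_one_minus_exp_le[OF _ q tail s] by (simp add: mult_ac)
qed

text \<open>Here the tail is integrable at 0, and its Laplace transform is a gamma integral. The
  deficit is integrable too and bounded by a tail with \<open>q = c + 1/2 < 1\<close>, which fixes
  the order of the remainder.\<close>

lemma laplace_precision_weight_less_half:
  assumes c2: "c < 1/2" and s: "0 < s"
  shows "\<bar>(\<integral>u. precision_weight c a u * exp (- (s * u)) \<partial>lborel) - Gamma (1/2 - c) * s powr (c - 1/2)
      + (\<integral>u. pos_powr (- c - 1/2) u - precision_weight c a u \<partial>lborel)\<bar>
    \<le> (c + a) * (Gamma (1/2 - c) / (c + 1/2) * s powr (c + 1/2))"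
proof -
  define h where "h u = pos_powr (- c - 1/2) u - precision_weight c a u" for u
  have [measurable]: "h \<in> borel_measurable borel" unfolding h_def by measurable
  have q: "0 < c + 1/2" "c + 1/2 < 1" and \<gamma>: "0 < 1/2 - c" using c c2 by auto
  have tail: "\<bar>h u\<bar> \<le> (c + a) * pos_powr (- 1 - (c + 1/2)) u" for u
    using precision_weight_deficit(1,3)[of u] by (simp add: h_def algebra_simps)
  have head: "\<bar>h u\<bar> \<le> 1 * pos_powr ((1/2 - c) - 1) u" for u
    using precision_weight_deficit(1,2)[of u] by (simp add: h_def algebra_simps)
  have h: "integrable lborel h" by (rule integrable_if_pos_powr_bounds[OF _ q tail \<gamma> head]) measurable
  have h_exp: "integrable lborel (\<lambda>u. h u * exp (- (s * u)))"
    using s by (intro integral_mult_exp_eq(1)[OF _ q tail h]) auto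
  have main: "has_bochner_integral lborel (\<lambda>u. pos_powr ((1/2 - c) - 1) u * exp (- (s * u))) (Gamma (1/2 - c) * s powr - (1/2 - c))"
    using \<gamma> s by (rule has_bochner_integral_pos_powr_exp)
  have "(\<integral>u. precision_weight c a u * exp (- (s * u)) \<partial>lborel)
      = (\<integral>u. pos_powr ((1/2 - c) - 1) u * exp (- (s * u)) - h u * exp (- (s * u)) \<partial>lborel)"
    by (simp add: h_def algebra_simps)
  also have "\<dots> = Gamma (1/2 - c) * s powr (c - 1/2) - (\<integral>u. h u * exp (- (s * u)) \<partial>lborel)"
    using main h_exp by (subst Bochner_Integration.integral_diff) (auto simp: has_bochner_integral_iff)
  also have "(\<integral>u. h u * exp (- (s * u)) \<partial>lborel) = (\<integral>u. h u \<partial>lborel) - (\<integral>u. h u * (1 - exp (- (s * u))) \<partial>lborel)"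
    using s by (intro integral_mult_exp_eq(2)[OF _ q tail h]) auto
  finally show ?thesis
    using abs_integral_mult_one_minus_exp_le[OF _ q tail, of s] s by (simp add: h_def[symmetric])
qed

end

text \<open>A Frullani integral: for \<open>u > 0\<close> the integrand is
  \<open>exp (- (x * u))\<close> integrated over \<open>x\<close> from \<open>s\<close> to
  \<open>s + 1\<close>, and after Fubini the integral over \<open>u\<close> is \<open>1 / x\<close>.
  Its logarithm is the leading term at \<open>c = 1/2\<close>.\<close>

lemma has_bochner_integral_frullani:
  assumes s: "0 < s"
  shows "has_bochner_integral lborel (\<lambda>u. pos_powr (- 1) u * (1 - exp (- u)) * exp (- (s * u))) (ln (1 + s) - ln s)"
proof (rule has_bochner_integral_nn_integral)
  let ?k = "\<lambda>u x. ennreal (pos_powr (1 - 1) u * exp (- (x * u))) * indicator {s..s + 1} x"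
  have "(\<integral>\<^sup>+u. ennreal (pos_powr (- 1) u * (1 - exp (- u)) * exp (- (s * u))) \<partial>lborel) = (\<integral>\<^sup>+u. \<integral>\<^sup>+x. ?k u x \<partial>lborel \<partial>lborel)"
  proof (rule nn_integral_cong)
    fix u :: real
    show "ennreal (pos_powr (- 1) u * (1 - exp (- u)) * exp (- (s * u))) = (\<integral>\<^sup>+x. ?k u x \<partial>lborel)"
    proof (cases "0 < u")
      case True
      have "(\<integral>\<^sup>+x. ennreal (exp (- (x * u))) * indicator {s..s + 1} x \<partial>lborel)
          = ennreal (- exp (- ((s + 1) * u)) / u - - exp (- (s * u)) / u)"
        using True by (intro nn_integral_FTC_Icc) (auto intro!: derivative_eq_intros)
      also have "- exp (- ((s + 1) * u)) / u - - exp (- (s * u)) / u = pos_powr (- 1) u * (1 - exp (- u)) * exp (- (s * u))"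
        using True by (simp add: pos_powr_pos powr_minus field_simps flip: exp_add)
      finally show ?thesis using True by (simp add: pos_powr_pos)
    qed simp
  qed
  also have "\<dots> = (\<integral>\<^sup>+x. \<integral>\<^sup>+u. ?k u x \<partial>lborel \<partial>lborel)"
    by (rule lborel_pair.Fubini') measurable
  also have "\<dots> = (\<integral>\<^sup>+x. ennreal (1 / x) * indicator {s..s + 1} x \<partial>lborel)"
  proof (rule nn_integral_cong)
    fix x :: real
    show "(\<integral>\<^sup>+u. ?k u x \<partial>lborel) = ennreal (1 / x) * indicator {s..s + 1} x"
    proof (cases "x \<in> {s..s + 1}")
      case True
      then show ?thesis using s
        by (subst nn_integral_multc, measurable, subst nn_integral_pos_powr_exp) (auto simp: powr_minus divide_inverse)
    qed simp
  qed
  also have "\<dots> = ennreal (ln (s + 1) - ln s)"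
    using s by (intro nn_integral_FTC_Icc) (auto intro!: derivative_eq_intros)
  finally show "(\<integral>\<^sup>+u. ennreal (pos_powr (- 1) u * (1 - exp (- u)) * exp (- (s * u))) \<partial>lborel) = ennreal (ln (1 + s) - ln s)"
    by (simp add: add.commute)
  show "AE u in lborel. 0 \<le> pos_powr (- 1) u * (1 - exp (- u)) * exp (- (s * u))"
  proof (rule AE_I2)
    fix u :: real
    show "0 \<le> pos_powr (- 1) u * (1 - exp (- u)) * exp (- (s * u))"
      by (cases "0 < u") auto
  qed
  show "0 \<le> ln (1 + s) - ln s" using s by simp
qed measurable

text \<open>Quadratic decay is the excluded case \<open>q = 1\<close> of the power estimate and
  costs a logarithm. The range is cut at 1 and at \<open>1 / s\<close>; the pieces contribute
  \<open>s\<close>, \<open>- s * ln s\<close> and \<open>s\<close>.\<close>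

lemma abs_integral_mult_one_minus_exp_le_log:
  assumes h [measurable]: "h \<in> borel_measurable borel" and M: "0 \<le> M"
    and h1: "\<And>u. \<bar>h u\<bar> \<le> M * pos_powr (- 1) u" and h2: "\<And>u. \<bar>h u\<bar> \<le> M * pos_powr (- 2) u"
    and int: "integrable lborel (\<lambda>u. h u * (1 - exp (- (s * u))))"
    and s: "0 < s" "s < 1"
  shows "\<bar>\<integral>u. h u * (1 - exp (- (s * u))) \<partial>lborel\<bar> \<le> M * (2 * s - s * ln s)"
proof -
  have "ennreal (norm (\<integral>u. h u * (1 - exp (- (s * u))) \<partial>lborel))
      \<le> (\<integral>\<^sup>+u. ennreal (norm (h u * (1 - exp (- (s * u))))) \<partial>lborel)"
    using int by (rule integral_norm_bound_ennreal)
  also have "\<dots> \<le> (\<integral>\<^sup>+u. ennreal M * (ennreal s * indicator {0..1} u + ennreal (s / u) * indicator {1..1/s} u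
      + ennreal (pos_powr (- 1 - 1) u) * indicator {1/s..} u) \<partial>lborel)"
  proof (rule nn_integral_mono)
    fix u :: real
    have mul: "\<bar>h u * (1 - exp (- (s * u)))\<bar> \<le> M * (p * e)"
      if "\<bar>h u\<bar> \<le> M * p" "1 - exp (- (s * u)) \<le> e" "0 < u" "0 \<le> p" for p e
      using mult_mono[OF that(1,2)] that(3,4) s M by (simp add: abs_mult mult_ac)
    have e: "1 - exp (- (s * u)) \<le> s * u" using exp_ge_add_one_self[of "- (s * u)"] by simp
    \<comment> \<open>Below \<open>1 / s\<close> the factor \<open>1 - exp (- (s * u))\<close> is
      bounded by \<open>s * u\<close>, beyond it by 1. The bound \<open>h1\<close> serves
      \<open>u \<le> 1\<close>, and \<open>h2\<close> the rest.\<close>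
    consider "u \<le> 0" | "0 < u" "u \<le> 1" | "1 \<le> u" "u \<le> 1/s" | "1/s \<le> u" "0 < u" by linarith
    then show "ennreal (norm (h u * (1 - exp (- (s * u)))))
       \<le> ennreal M * (ennreal s * indicator {0..1} u + ennreal (s / u) * indicator {1..1/s} u
          + ennreal (pos_powr (- 1 - 1) u) * indicator {1/s..} u)"
    proof cases
      case 1
      then show ?thesis using h1[of u] by simp
    next
      case 2
      have "norm (h u * (1 - exp (- (s * u)))) \<le> M * (pos_powr (- 1) u * (s * u))"
        unfolding real_norm_def using 2 by (intro mul h1 e) auto
      also have "\<dots> = M * s" using 2 by (simp add: pos_powr_pos powr_minus)
      finally have "ennreal (norm (h u * (1 - exp (- (s * u))))) \<le> ennreal M * (ennreal s * indicator {0..1} u)"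
        using 2 M by (simp add: ennreal_leI flip: ennreal_mult')
      then show ?thesis by (rule order_trans) (intro mult_left_mono, simp_all add: add.assoc)
    next
      case 3
      have "norm (h u * (1 - exp (- (s * u)))) \<le> M * (pos_powr (- 2) u * (s * u))"
        unfolding real_norm_def using 3 by (intro mul h2 e) auto
      also have "pos_powr (- 2) u * (s * u) = s / u"
        using 3 by (simp add: pos_powr_pos powr_minus power2_eq_square divide_simps)
      finally have "ennreal (norm (h u * (1 - exp (- (s * u))))) \<le> ennreal M * (ennreal (s / u) * indicator {1..1/s} u)"
        using 3 M by (simp add: ennreal_leI flip: ennreal_mult')
      then show ?thesis
        by (rule order_trans) (intro mult_left_mono, simp_all add: add.commute[of "ennreal s * _"] add.assoc)
    next
      case 4
      have "norm (h u * (1 - exp (- (s * u)))) \<le> M * (pos_powr (- 2) u * 1)"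
        unfolding real_norm_def using 4 by (intro mul h2) auto
      then have "ennreal (norm (h u * (1 - exp (- (s * u))))) \<le> ennreal M * (ennreal (pos_powr (- 1 - 1) u) * indicator {1/s..} u)"
        using 4 M by (simp add: ennreal_leI flip: ennreal_mult')
      then show ?thesis by (rule order_trans) (intro mult_left_mono, simp_all)
    qed
  qed
  also have "\<dots> = ennreal M * (ennreal s * ennreal 1 + ennreal (s * ln (1/s) - s * ln 1) + ennreal ((1/s) powr - 1 / 1))"
  proof -
    have "(\<integral>\<^sup>+u. ennreal (s / u) * indicator {1..1/s} u \<partial>lborel) = ennreal (s * ln (1/s) - s * ln 1)"
      using s by (intro nn_integral_FTC_Icc) (auto intro!: derivative_eq_intros)
    moreover have "(\<integral>\<^sup>+u. ennreal (pos_powr (- 1 - 1) u) * indicator {1/s..} u \<partial>lborel) = ennreal ((1/s) powr - 1 / 1)"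
      using s by (intro nn_integral_pos_powr_atLeast) auto
    moreover have "(\<integral>\<^sup>+u. ennreal s * indicator {0..1::real} u \<partial>lborel) = ennreal s * ennreal 1"
      by (subst nn_integral_cmult_indicator) auto
    moreover have "(\<integral>\<^sup>+u. ennreal M * (ennreal s * indicator {0..1} u + ennreal (s / u) * indicator {1..1/s} u
        + ennreal (pos_powr (- 1 - 1) u) * indicator {1/s..} u) \<partial>lborel)
      = ennreal M * (\<integral>\<^sup>+u. ennreal s * indicator {0..1} u + ennreal (s / u) * indicator {1..1/s} u
        + ennreal (pos_powr (- 1 - 1) u) * indicator {1/s..} u \<partial>lborel)"
      by (rule nn_integral_cmult) measurable
    moreover have "(\<integral>\<^sup>+u. ennreal s * indicator {0..1} u + ennreal (s / u) * indicator {1..1/s} u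
        + ennreal (pos_powr (- 1 - 1) u) * indicator {1/s..} u \<partial>lborel)
      = (\<integral>\<^sup>+u. ennreal s * indicator {0..1} u + ennreal (s / u) * indicator {1..1/s} u \<partial>lborel)
        + (\<integral>\<^sup>+u. ennreal (pos_powr (- 1 - 1) u) * indicator {1/s..} u \<partial>lborel)"
      by (rule nn_integral_add) measurable
    moreover have "(\<integral>\<^sup>+u. ennreal s * indicator {0..1} u + ennreal (s / u) * indicator {1..1/s} u \<partial>lborel)
      = (\<integral>\<^sup>+u. ennreal s * indicator {0..1::real} u \<partial>lborel) + (\<integral>\<^sup>+u. ennreal (s / u) * indicator {1..1/s} u \<partial>lborel)"
      by (rule nn_integral_add) measurable
    ultimately show ?thesis by (simp only:)
  qed
  also have "\<dots> = ennreal (M * (2 * s - s * ln s))"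
  proof -
    have "ln s < 0" using s by simp
    then have "0 \<le> s * ln (1/s) - s * ln 1" "(1/s) powr - 1 / 1 = s"
      using s by (simp_all add: ln_div powr_minus mult_nonneg_nonpos)
    moreover have "0 \<le> s" using s by simp
    ultimately have "ennreal M * (ennreal s * ennreal 1 + ennreal (s * ln (1/s) - s * ln 1) + ennreal ((1/s) powr - 1 / 1))
        = ennreal (M * (s + (s * ln (1/s) - s * ln 1) + s))"
      by (simp only: ennreal_1 mult_1_right ennreal_mult'[OF M] ennreal_plus add_nonneg_nonneg)
    also have "s + (s * ln (1/s) - s * ln 1) + s = 2 * s - s * ln s"
      using s by (simp add: ln_div algebra_simps)
    finally show ?thesis .
  qed
  finally have "ennreal \<bar>\<integral>u. h u * (1 - exp (- (s * u))) \<partial>lborel\<bar> \<le> ennreal (M * (2 * s - s * ln s))"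
    by simp
  moreover have "s * ln s \<le> 0" using s ln_less_zero[OF s] by (intro mult_nonneg_nonpos) auto
  then have "0 \<le> 2 * s - s * ln s" using s by linarith
  then have "0 \<le> M * (2 * s - s * ln s)" using M by (rule mult_nonneg_nonneg[rotated])
  ultimately show ?thesis by (simp only: ennreal_le_iff)
qed

text \<open>Bounds \<open>(1 - exp (- u)) / u\<close> by \<open>u powr (- 1/2)\<close>, an
  integrable singularity that also bounds the weight at \<open>c = 1/2\<close>.\<close>

lemma one_minus_exp_le_sqrt:
  fixes u :: real
  assumes "0 < u"
  shows "1 - exp (- u) \<le> u powr (1/2)"
proof (cases "u \<le> 1")
  case True
  have "1 - exp (- u) \<le> u powr 1" using exp_ge_add_one_self[of "- u"] assms by simp
  also have "\<dots> \<le> u powr (1/2)" using True assms by (intro powr_mono') auto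
  finally show ?thesis .
next
  case False
  then have "1 \<le> u powr (1/2)" using ge_one_powr_ge_zero[of u "1/2"] by simp
  then show ?thesis by (rule order_trans[rotated]) simp
qed

lemma laplace_precision_weight_half:
  assumes a: "0 < a"
  shows "\<exists>k. \<forall>s. 0 < s \<longrightarrow> s < 1 \<longrightarrow>
    \<bar>(\<integral>u. precision_weight (1/2) a u * exp (- (s * u)) \<partial>lborel) + ln s - k\<bar> \<le> s + (a + 3/2) * (2 * s - s * ln s)"
proof -
  \<comment> \<open>The weight is compared with \<open>(1 - exp (- u)) / u\<close>, which has the same tail \<open>1 / u\<close>
    and an elementary Laplace transform.\<close>
  define g where "g u = pos_powr (- 1) u * (1 - exp (- u))" for u
  define h where "h u = precision_weight (1/2) a u - g u" for u
  have [measurable]: "g \<in> borel_measurable borel" unfolding g_def by measurable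
  have hm [measurable]: "h \<in> borel_measurable borel" unfolding h_def by measurable
  have half: "(0 :: real) < 1/2" by simp
  note deficit = precision_weight_deficit[OF half a]
  have g0: "0 \<le> g u" for u by (cases "0 < u") (auto simp: g_def)
  have h1: "\<bar>h u\<bar> \<le> pos_powr (- 1) u" for u
  proof -
    have "g u \<le> pos_powr (- 1) u" unfolding g_def by (intro mult_left_le) auto
    then show ?thesis
      using deficit(1)[of u] g0[of u] precision_weight_nonneg[of "1/2" a u] by (simp add: h_def abs_le_iff)
  qed
  \<comment> \<open>The constant is \<open>1/2 + a\<close> from the deficit of the weight, plus 1
    from \<open>exp (- u) / u \<le> u powr (- 2)\<close>.\<close>
  have h2: "\<bar>h u\<bar> \<le> (a + 3/2) * pos_powr (- 2) u" for u
  proof (cases "0 < u")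
    case True
    have "u \<le> exp u" using exp_ge_add_one_self[of u] by linarith
    then have "exp (- u) \<le> 1 / u" using True by (simp add: exp_minus field_simps)
    then have "pos_powr (- 1) u * exp (- u) \<le> pos_powr (- 1) u * (1 / u)" by (intro mult_left_mono) auto
    also have "\<dots> = pos_powr (- 2) u" using True by (simp add: pos_powr_pos powr_minus power2_eq_square divide_simps)
    finally have "pos_powr (- 1) u * exp (- u) \<le> pos_powr (- 2) u" .
    moreover have "0 \<le> pos_powr (- 1) u * exp (- u)" by simp
    moreover have "h u = pos_powr (- 1) u * exp (- u) - (pos_powr (- 1) u - precision_weight (1/2) a u)"
      by (simp add: h_def g_def algebra_simps)
    moreover have "pos_powr (- 1) u - precision_weight (1/2) a u \<le> (1/2 + a) * pos_powr (- 2) u"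
      "0 \<le> pos_powr (- 1) u - precision_weight (1/2) a u"
      using deficit(1,3)[of u] by simp_all
    moreover have "(a + 3/2) * pos_powr (- 2) u = (1/2 + a) * pos_powr (- 2) u + pos_powr (- 2) u"
      by (simp add: algebra_simps)
    moreover have "0 \<le> (1/2 + a) * pos_powr (- 2) u" "0 \<le> pos_powr (- 2) u" using a by auto
    ultimately show ?thesis unfolding abs_le_iff by linarith
  qed (simp add: h_def g_def precision_weight_def)
  have head: "\<bar>h u\<bar> \<le> 1 * pos_powr (1/2 - 1) u" for u
  proof -
    have "g u \<le> pos_powr (- 1/2) u"
    proof (cases "0 < u")
      case True
      then have "g u \<le> u powr (- 1) * u powr (1/2)"
        unfolding g_def pos_powr_pos[OF True] by (intro mult_left_mono one_minus_exp_le_sqrt) auto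
      also have "\<dots> = pos_powr (- 1/2) u" unfolding pos_powr_pos[OF True] powr_add[symmetric] by simp
      finally show ?thesis .
    qed (simp add: g_def)
    moreover have "precision_weight (1/2) a u \<le> pos_powr (- 1/2) u"
      using precision_weight_le_pos_powr[of a "1/2" a u] a by simp
    ultimately show ?thesis
      using g0[of u] precision_weight_nonneg[of "1/2" a u] by (simp add: h_def abs_le_iff)
  qed
  \<comment> \<open>The choice \<open>q = 1/2\<close> provides integrability only; the sharp
    remainder comes from \<open>h2\<close> through the logarithmic estimate.\<close>
  have tail: "\<bar>h u\<bar> \<le> (a + 3/2) * pos_powr (- 1 - 1/2) u" for u
  proof (cases "0 < u")
    case True
    show ?thesis
    proof (cases "u \<le> 1")
      case True
      have "\<bar>h u\<bar> \<le> u powr (- 1)" using h1[of u] \<open>0 < u\<close> by (simp add: pos_powr_pos)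
      also have "\<dots> \<le> u powr (- 1 - 1/2)" using True \<open>0 < u\<close> by (intro powr_mono') auto
      also have "\<dots> \<le> (a + 3/2) * u powr (- 1 - 1/2)" using a by (intro mult_le_cancel_right1[THEN iffD2]) auto
      finally show ?thesis using \<open>0 < u\<close> by (simp add: pos_powr_pos)
    next
      case False
      have "\<bar>h u\<bar> \<le> (a + 3/2) * u powr (- 2)" using h2[of u] \<open>0 < u\<close> by (simp add: pos_powr_pos)
      also have "\<dots> \<le> (a + 3/2) * u powr (- 1 - 1/2)" using False a by (intro mult_left_mono powr_mono) auto
      finally show ?thesis using \<open>0 < u\<close> by (simp add: pos_powr_pos)
    qed
  qed (use h1[of u] in simp)
  have half1: "(1/2 :: real) < 1" by simp
  have hint: "integrable lborel h" by (rule integrable_if_pos_powr_bounds[OF hm half half1 tail half head])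
  have "\<bar>(\<integral>u. precision_weight (1/2) a u * exp (- (s * u)) \<partial>lborel) + ln s - (\<integral>u. h u \<partial>lborel)\<bar>
      \<le> s + (a + 3/2) * (2 * s - s * ln s)" if s: "0 < s" "s < 1" for s
  proof -
    have s0: "0 \<le> s" using s by simp
    have frullani: "has_bochner_integral lborel (\<lambda>u. g u * exp (- (s * u))) (ln (1 + s) - ln s)"
      unfolding g_def using s(1) by (rule has_bochner_integral_frullani)
    have "(\<integral>u. precision_weight (1/2) a u * exp (- (s * u)) \<partial>lborel)
        = (\<integral>u. g u * exp (- (s * u)) + h u * exp (- (s * u)) \<partial>lborel)"
      by (simp add: h_def algebra_simps)
    also have "\<dots> = (ln (1 + s) - ln s) + (\<integral>u. h u * exp (- (s * u)) \<partial>lborel)"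
      using frullani integral_mult_exp_eq(1)[OF hm half half1 tail hint s0]
      by (subst Bochner_Integration.integral_add) (auto simp: has_bochner_integral_iff)
    also have "(\<integral>u. h u * exp (- (s * u)) \<partial>lborel) = (\<integral>u. h u \<partial>lborel) - (\<integral>u. h u * (1 - exp (- (s * u))) \<partial>lborel)"
      by (rule integral_mult_exp_eq(2)[OF hm half half1 tail hint s0])
    finally have eq: "(\<integral>u. precision_weight (1/2) a u * exp (- (s * u)) \<partial>lborel) + ln s - (\<integral>u. h u \<partial>lborel)
       = ln (1 + s) - (\<integral>u. h u * (1 - exp (- (s * u))) \<partial>lborel)" by simp
    have "\<bar>\<integral>u. h u * (1 - exp (- (s * u))) \<partial>lborel\<bar> \<le> (a + 3/2) * (2 * s - s * ln s)"
    proof (rule abs_integral_mult_one_minus_exp_le_log[OF hm _ _ h2 integrable_mult_one_minus_exp[OF hm half half1 tail s0] s])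
      show "0 \<le> a + 3/2" using a by simp
      have "pos_powr (- 1) u \<le> (a + 3/2) * pos_powr (- 1) u" for u
        using a mult_right_mono[of 1 "a + 3/2" "pos_powr (- 1) u"] by simp
      then show "\<bar>h u\<bar> \<le> (a + 3/2) * pos_powr (- 1) u" for u
        using h1[of u] order_trans by blast
    qed
    \<comment> \<open>The Frullani integral exceeds \<open>- ln s\<close> by
      \<open>ln (1 + s)\<close>, the source of the summand \<open>s\<close> in the bound.\<close>
    moreover have "0 \<le> ln (1 + s)" "ln (1 + s) \<le> s" using s by (auto intro: ln_add_one_self_le_self)
    ultimately show ?thesis unfolding eq by linarith
  qed
  then show ?thesis by blast
qed

section \<open>Behaviour at zero\<close>

lemma tendsto_abs_powr_0:
  assumes "0 < e"
  shows "((\<lambda>y :: real. \<bar>y\<bar> powr e) \<longlongrightarrow> 0) (at 0 within S)"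
proof (rule tendsto_zero_powrI)
  show "((\<lambda>y :: real. \<bar>y\<bar>) \<longlongrightarrow> 0) (at 0 within S)" by (intro tendsto_eq_intros) auto
qed (use assms in auto)

text \<open>A remainder of order above 1 still vanishes after division by
  \<open>\<bar>y\<bar>\<close>. The set \<open>S\<close> makes the argument available for one-sided
  derivatives.\<close>

lemma has_real_derivative_if_expansion:
  fixes f :: "real \<Rightarrow> real"
  assumes f: "\<And>y. y \<in> S \<Longrightarrow> \<bar>f y - f 0 - d * y\<bar> \<le> K * \<bar>y\<bar> powr r" and r: "1 < r"
  shows "(f has_real_derivative d) (at 0 within S)"
  unfolding has_field_derivative_iff
proof (rule LIM_zero_cancel, rule Lim_null_comparison)
  show "((\<lambda>y. K * \<bar>y\<bar> powr (r - 1)) \<longlongrightarrow> 0) (at 0 within S)"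
    using tendsto_mult_right_zero[OF tendsto_abs_powr_0[of "r - 1" S]] r by simp
  have "norm ((f y - f 0) / (y - 0) - d) \<le> K * \<bar>y\<bar> powr (r - 1)" if "y \<in> S" "y \<noteq> 0" for y
  proof -
    have "norm ((f y - f 0) / (y - 0) - d) = \<bar>f y - f 0 - d * y\<bar> / \<bar>y\<bar>"
      using that by (simp add: field_simps flip: abs_divide)
    also have "\<dots> \<le> K * \<bar>y\<bar> powr r / \<bar>y\<bar>" using f[OF that(1)] by (rule divide_right_mono) simp
    also have "\<dots> = K * \<bar>y\<bar> powr (r - 1)" using that by (simp add: powr_diff)
    finally show ?thesis .
  qed
  then show "\<forall>\<^sub>F y in at 0 within S. norm ((f y - f 0) / (y - 0) - d) \<le> K * \<bar>y\<bar> powr (r - 1)"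
    by (auto simp: eventually_at_filter)
qed

lemma half_square_powr: "(b\<^sup>2 / 2) powr q = 2 powr - q * \<bar>b\<bar> powr (2 * q)" for b q :: real
proof (cases "b = 0")
  case False
  have "b\<^sup>2 = \<bar>b\<bar> powr 2" using False by simp
  then have "(b\<^sup>2) powr q = \<bar>b\<bar> powr (2 * q)" by (simp only: powr_powr)
  then show ?thesis by (simp add: powr_divide powr_minus_divide)
qed simp

text \<open>The constant \<open>k\<close> is in general not of order \<open>g\<close>, but
  \<open>m\<close> tends to infinity, so \<open>k\<close> is negligible against
  \<open>m b + r b\<close> and disappears under asymptotic equivalence.\<close>

lemma unbounded_expansion_at_0:
  fixes f m r g :: "real \<Rightarrow> real"
  assumes r: "r \<in> O[at 0](g)" and g: "(g \<longlongrightarrow> 0) (at 0)" and m: "filterlim m at_top (at 0)"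
    and f: "\<And>b. b \<noteq> 0 \<Longrightarrow> f b = m b + r b + k"
  shows "filterlim f at_top (at 0)" and "f \<sim>[at 0] (\<lambda>b. m b + r b)" and "\<not> bounded (range f)"
proof -
  obtain C where C: "\<forall>\<^sub>F b in at 0. norm (r b) \<le> C * norm (g b)" using r by (rule landau_o.bigE)
  have r0: "(r \<longlongrightarrow> 0) (at 0)"
    by (rule Lim_null_comparison[OF C]) (use g in \<open>auto intro!: tendsto_eq_intros\<close>)
  have ev: "\<forall>\<^sub>F b in at 0. f b = m b + r b + k"
    using f by (auto simp: eventually_at_filter)
  have mr: "filterlim (\<lambda>b. m b + r b) at_top (at 0)"
    using filterlim_tendsto_add_at_top[OF r0 m] by (simp add: add.commute)
  have "filterlim (\<lambda>b. k + (m b + r b)) at_top (at 0)"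
    by (rule filterlim_tendsto_add_at_top[OF tendsto_const mr])
  then show lim: "filterlim f at_top (at 0)"
    by (rule filterlim_mono_eventually[OF _ order_refl order_refl]) (use ev in \<open>auto elim!: eventually_mono simp: add.commute\<close>)
  show "f \<sim>[at 0] (\<lambda>b. m b + r b)"
  proof (rule smallo_imp_asymp_equiv)
    have "(\<lambda>_. k) \<in> o[at 0](\<lambda>b. m b + r b)"
    proof (rule smalloI_tendsto)
      show "((\<lambda>b. k / (m b + r b)) \<longlongrightarrow> 0) (at 0)"
        by (rule tendsto_divide_0[OF tendsto_const filterlim_at_top_imp_at_infinity[OF mr]])
      show "\<forall>\<^sub>F b in at 0. m b + r b \<noteq> 0"
        using filterlim_at_top_dense[THEN iffD1, OF mr, rule_format, of 0] by eventually_elim simp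
    qed
    moreover have "\<forall>\<^sub>F b in at 0. f b - (m b + r b) = k"
      using ev by eventually_elim simp
    ultimately show "(\<lambda>b. f b - (m b + r b)) \<in> o[at 0](\<lambda>b. m b + r b)"
      by (simp cong: landau_o.small.in_cong)
  qed
  show "\<not> bounded (range f)"
  proof
    assume "bounded (range f)"
    then obtain B where B: "\<And>b. norm (f b) \<le> B" by (auto simp: bounded_iff)
    have "\<forall>\<^sub>F b in at 0. B < f b" using lim by (simp add: filterlim_at_top_dense)
    then obtain b where "B < f b" using eventually_happens'[OF at_neq_bot] by blast
    then show False using B[of b] by simp
  qed
qed

lemma filterlim_abs_powr_at_top:
  assumes "e < 0"
  shows "filterlim (\<lambda>b :: real. \<bar>b\<bar> powr e) at_top (at 0)"
proof -
  have "filterlim (\<lambda>b :: real. inverse (\<bar>b\<bar> powr - e)) at_top (at 0)"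
    using assms by (intro filterlim_inverse_at_top tendsto_abs_powr_0) (auto simp: eventually_at_filter)
  then show ?thesis by (simp add: powr_minus)
qed

lemma filterlim_minus_ln_square: "filterlim (\<lambda>b :: real. - ln (b\<^sup>2)) at_top (at 0)"
proof -
  have "filterlim (\<lambda>b :: real. b\<^sup>2) (at_right 0) (at 0)"
    unfolding filterlim_at by (auto intro!: tendsto_eq_intros simp: eventually_at_filter)
  then have "filterlim (\<lambda>b :: real. ln (b\<^sup>2)) at_bot (at 0)" by (rule filterlim_compose[OF ln_at_0])
  then show ?thesis by (simp add: filterlim_uminus_at_top)
qed

lemma tendsto_square_mult_ln_square: "((\<lambda>b :: real. b\<^sup>2 * ln (b\<^sup>2)) \<longlongrightarrow> 0) (at 0)"
proof (rule Lim_null_comparison)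
  show "((\<lambda>b :: real. 2 * \<bar>b\<bar>) \<longlongrightarrow> 0) (at 0)" by (intro tendsto_eq_intros) auto
  have "norm (b\<^sup>2 * ln (b\<^sup>2)) \<le> 2 * \<bar>b\<bar>" if b: "b \<noteq> 0" "\<bar>b\<bar> < 1" for b :: real
  proof -
    have "ln (b\<^sup>2) = - 2 * ln (1 / \<bar>b\<bar>)"
      using b ln_realpow[of "\<bar>b\<bar>" 2] by (simp add: ln_div)
    moreover have "0 \<le> ln (1 / \<bar>b\<bar>)" using b by (intro ln_ge_zero) (simp add: field_simps)
    ultimately have "norm (b\<^sup>2 * ln (b\<^sup>2)) = 2 * b\<^sup>2 * ln (1 / \<bar>b\<bar>)"
      by (simp add: abs_mult)
    \<comment> \<open>\<open>ln x \<le> x - 1\<close> at \<open>x = 1 / \<bar>b\<bar>\<close> trades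
      the logarithm for one power of \<open>b\<close>.\<close>
    also have "\<dots> \<le> 2 * b\<^sup>2 * (1 / \<bar>b\<bar>)"
      using b ln_le_minus_one[of "1 / \<bar>b\<bar>"] by (intro mult_left_mono) auto
    also have "\<dots> = 2 * \<bar>b\<bar>" using b by (simp add: power2_eq_square abs_if)
    finally show ?thesis .
  qed
  then show "\<forall>\<^sub>F b :: real in at 0. norm (b\<^sup>2 * ln (b\<^sup>2)) \<le> 2 * \<bar>b\<bar>"
    unfolding eventually_at by (intro exI[of _ 1]) auto
qed

text \<open>For \<open>c < 1/2\<close> the expansion has a nonzero constant term, which no multiple
  of \<open>\<bar>b\<bar> powr (2 * c + 1)\<close> absorbs; so the stated form is claimed up to
  asymptotic equivalence, and the exact identity carries a separate \<open>k\<close>. At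
  \<open>c = 1\<close> the density behaves like \<open>f 0 - d * \<bar>b\<bar>\<close> with
  \<open>d > 0\<close>: a corner, with one-sided derivatives only. Two-sided differentiability is
  therefore claimed above 1.\<close>

theorem proposition5:
  fixes G :: nat and p :: "nat \<Rightarrow> nat" and aG a2 c :: real and g l :: nat and f :: "real \<Rightarrow> real"
  assumes "aG > 0" and "a2 > 0"
    and "\<And>h. h < G \<Longrightarrow> p h > 0"
    and "g < G" and "l < p g"
    and "c = aG / real (p g)"
    and "f = coef_marginal_density G p aG a2 g l"
  shows
    "distributed (group_R2_prior G p aG a2) lborel (\<lambda>(\<theta>, b). b (g, l)) (\<lambda>x. ennreal (f x))
     \<and> (c \<le> 1/2 \<longrightarrow> \<not> bounded (range f) \<and> filterlim f at_top (at 0))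
     \<and> (c < 1/2 \<longrightarrow>
         (\<exists>c1>0. \<exists>r\<in>O[at 0](\<lambda>b. \<bar>b\<bar> powr (2 * c + 1)).
            f \<sim>[at 0] (\<lambda>b. c1 * \<bar>b\<bar> powr (2 * c - 1) + r b)
            \<and> (\<exists>k. \<forall>b. b \<noteq> 0 \<longrightarrow> f b = c1 * \<bar>b\<bar> powr (2 * c - 1) + r b + k)))
     \<and> (c = 1/2 \<longrightarrow>
         (\<exists>c2>0. \<exists>r\<in>O[at 0](\<lambda>b. b\<^sup>2 * ln (b\<^sup>2)).
            f \<sim>[at 0] (\<lambda>b. - c2 * ln (b\<^sup>2) + r b)
            \<and> (\<exists>k. \<forall>b. b \<noteq> 0 \<longrightarrow> f b = - c2 * ln (b\<^sup>2) + r b + k)))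
     \<and> (c > 1/2 \<longrightarrow> bounded (range f) \<and> isCont f 0)
     \<and> (c > 1 \<longrightarrow> f differentiable (at 0))
     \<and> (c \<ge> 1 \<longrightarrow> f differentiable (at 0 within {0..}) \<and> f differentiable (at 0 within {..0}))"
proof -
  interpret group_R2 G p aG a2 using assms by unfold_locales auto
  have c: "0 < c" using assms(1,6) assms(3)[OF assms(4)] by simp
  define C where "C = 1 / (Beta c a2 * sqrt (2 * pi))"
  define L where "L s = (\<integral>u. precision_weight c a2 u * exp (- (s * u)) \<partial>lborel)" for s
  have C: "0 < C" using Beta_real_pos[OF c assms(2)] by (simp add: C_def)
  have f: "f b = C * L (b\<^sup>2 / 2)" for b
    unfolding C_def L_def assms(7) by (rule coef_marginal_density_eq[OF assms(4-6)])
  have dist: "distributed (group_R2_prior G p aG a2) lborel (\<lambda>(\<theta>, b). b (g, l)) (\<lambda>x. ennreal (f x))"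
    unfolding assms(7) by (rule distributed_coef[OF assms(4,5)])
  have less: "\<exists>c1>0. \<exists>r\<in>O[at 0](\<lambda>b. \<bar>b\<bar> powr (2 * c + 1)).
      f \<sim>[at 0] (\<lambda>b. c1 * \<bar>b\<bar> powr (2 * c - 1) + r b)
      \<and> (\<exists>k. \<forall>b. b \<noteq> 0 \<longrightarrow> f b = c1 * \<bar>b\<bar> powr (2 * c - 1) + r b + k)"
    and less_lim: "\<not> bounded (range f) \<and> filterlim f at_top (at 0)" if lt: "c < 1/2"
  proof -
    define I where "I = (\<integral>u. pos_powr (- c - 1/2) u - precision_weight c a2 u \<partial>lborel)"
    \<comment> \<open>The power of 2 comes from \<open>half_square_powr\<close> with exponent
      \<open>c - 1/2\<close>.\<close>
    define c1 where "c1 = C * Gamma (1/2 - c) * 2 powr (1/2 - c)"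
    \<comment> \<open>Defined as what is left over, so the identity for \<open>f\<close> is
      immediate and the content lies in the bound on \<open>r\<close>.\<close>
    define r where "r b = f b - c1 * \<bar>b\<bar> powr (2 * c - 1) - (- C * I)" for b
    define K where "K = C * ((c + a2) * (Gamma (1/2 - c) / (c + 1/2) * 2 powr - (c + 1/2)))"
    have c1: "0 < c1" using C lt by (simp add: c1_def Gamma_real_pos)
    have bound: "\<bar>r b\<bar> \<le> K * \<bar>b\<bar> powr (2 * c + 1)" if b: "b \<noteq> 0" for b
    proof -
      have s: "0 < b\<^sup>2 / 2" using b by simp
      have "r b = C * (L (b\<^sup>2 / 2) - Gamma (1/2 - c) * (b\<^sup>2 / 2) powr (c - 1/2) + I)"
        unfolding r_def f c1_def half_square_powr by (simp add: algebra_simps)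
      then have "\<bar>r b\<bar> = C * \<bar>L (b\<^sup>2 / 2) - Gamma (1/2 - c) * (b\<^sup>2 / 2) powr (c - 1/2) + I\<bar>"
        using C by (simp add: abs_mult)
      also have "\<dots> \<le> C * ((c + a2) * (Gamma (1/2 - c) / (c + 1/2) * (b\<^sup>2 / 2) powr (c + 1/2)))"
        unfolding L_def I_def using C laplace_precision_weight_less_half[OF c assms(2) lt s] by (intro mult_left_mono) auto
      also have "\<dots> = K * \<bar>b\<bar> powr (2 * c + 1)"
        unfolding K_def half_square_powr by (simp add: algebra_simps)
      finally show ?thesis .
    qed
    have r: "r \<in> O[at 0](\<lambda>b. \<bar>b\<bar> powr (2 * c + 1))"
      by (rule bigoI[of _ K]) (use bound in \<open>auto simp: eventually_at_filter\<close>)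
    have m: "filterlim (\<lambda>b. c1 * \<bar>b\<bar> powr (2 * c - 1)) at_top (at 0)"
      using lt by (intro filterlim_tendsto_pos_mult_at_top[OF tendsto_const c1] filterlim_abs_powr_at_top) auto
    have f_eq: "f b = c1 * \<bar>b\<bar> powr (2 * c - 1) + r b + (- C * I)" for b by (simp add: r_def)
    have "2 * c + 1 > 0" using c by simp
    note expansion = unbounded_expansion_at_0[OF r tendsto_abs_powr_0[OF this] m f_eq]
    show "\<not> bounded (range f) \<and> filterlim f at_top (at 0)" using expansion by blast
    show "\<exists>c1>0. \<exists>r\<in>O[at 0](\<lambda>b. \<bar>b\<bar> powr (2 * c + 1)).
      f \<sim>[at 0] (\<lambda>b. c1 * \<bar>b\<bar> powr (2 * c - 1) + r b)
      \<and> (\<exists>k. \<forall>b. b \<noteq> 0 \<longrightarrow> f b = c1 * \<bar>b\<bar> powr (2 * c - 1) + r b + k)"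
      by (intro exI[of _ c1] conjI bexI[of _ r] exI[of _ "- C * I"] allI impI c1 r expansion(2) f_eq)
  qed
  have half: "\<exists>c2>0. \<exists>r\<in>O[at 0](\<lambda>b. b\<^sup>2 * ln (b\<^sup>2)).
      f \<sim>[at 0] (\<lambda>b. - c2 * ln (b\<^sup>2) + r b)
      \<and> (\<exists>k. \<forall>b. b \<noteq> 0 \<longrightarrow> f b = - c2 * ln (b\<^sup>2) + r b + k)"
    and half_lim: "\<not> bounded (range f) \<and> filterlim f at_top (at 0)" if eq: "c = 1/2"
  proof -
    obtain I where I: "\<And>s. 0 < s \<Longrightarrow> s < 1 \<Longrightarrow> \<bar>L s + ln s - I\<bar> \<le> s + (a2 + 3/2) * (2 * s - s * ln s)"
      using laplace_precision_weight_half[OF assms(2)] unfolding L_def eq by blast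
    \<comment> \<open>The summand \<open>ln 2\<close> compensates for
      \<open>ln (b\<^sup>2 / 2) = ln (b\<^sup>2) - ln 2\<close>.\<close>
    define k where "k = C * (I + ln 2)"
    define r where "r b = f b - - C * ln (b\<^sup>2) - k" for b
    define M where "M = a2 + 3/2"
    have M: "0 < M" using assms(2) by (simp add: M_def)
    define K where "K = C * (1 + 4 * M)"
    \<comment> \<open>Below \<open>exp (- 1)\<close> one has \<open>- ln (b\<^sup>2) > 1\<close>, so
      constants are absorbed into the logarithm; \<open>2 + ln 2 \<le> 3\<close> leads to the factor
      4 in \<open>K\<close>.\<close>
    have bound: "\<bar>r b\<bar> \<le> K * \<bar>b\<^sup>2 * ln (b\<^sup>2)\<bar>" if b: "b \<noteq> 0" "b\<^sup>2 < exp (- 1)" for b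
    proof -
      let ?s = "b\<^sup>2 / 2"
      have x: "0 < b\<^sup>2" using b by simp
      have ln_s: "ln ?s = ln (b\<^sup>2) - ln 2" using b by (simp add: ln_div)
      have ln2: "ln 2 \<le> (1 :: real)" using ln_le_minus_one[of "2 :: real"] by simp
      have ln_b: "ln (b\<^sup>2) < - 1" using b x ln_less_cancel_iff[of "b\<^sup>2" "exp (- 1)"] by simp
      have "exp (- 1) < (1 :: real)" by simp
      then have s: "0 < ?s" "?s < 1" using b x by linarith+
      have "r b = C * (L ?s + ln ?s - I)" unfolding r_def f k_def ln_s by (simp add: algebra_simps)
      then have "\<bar>r b\<bar> = C * \<bar>L ?s + ln ?s - I\<bar>" using C by (simp add: abs_mult)
      also have "\<dots> \<le> C * (?s + M * (2 * ?s - ?s * ln ?s))"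
        using C I[OF s] by (intro mult_left_mono) (auto simp: M_def)
      also have "\<dots> = C * (b\<^sup>2 * ((1 + M * (2 + ln 2 - ln (b\<^sup>2))) / 2))"
        unfolding ln_s by (simp add: field_simps)
      also have "\<dots> \<le> C * (b\<^sup>2 * ((1 + 4 * M) * - ln (b\<^sup>2)))"
      proof (intro mult_left_mono)
        have "M * (2 + ln 2 - ln (b\<^sup>2)) \<le> M * (4 * - ln (b\<^sup>2))"
          using M ln2 ln_b by (intro mult_left_mono) auto
        then have "1 + M * (2 + ln 2 - ln (b\<^sup>2)) \<le> (1 + 4 * M) * - ln (b\<^sup>2)"
          using ln_b by (simp add: algebra_simps)
        moreover have "0 \<le> (1 + 4 * M) * - ln (b\<^sup>2)" using M ln_b by (intro mult_nonneg_nonneg) auto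
        moreover have "x / 2 \<le> y" if "x \<le> y" "0 \<le> y" for x y :: real using that by linarith
        ultimately show "(1 + M * (2 + ln 2 - ln (b\<^sup>2))) / 2 \<le> (1 + 4 * M) * - ln (b\<^sup>2)" by blast
      qed (use C in auto)
      also have "\<dots> = K * \<bar>b\<^sup>2 * ln (b\<^sup>2)\<bar>" using ln_b by (simp add: K_def abs_mult)
      finally show ?thesis .
    qed
    have "((\<lambda>b :: real. b\<^sup>2) \<longlongrightarrow> 0) (at 0)" by (intro tendsto_eq_intros) auto
    then have "\<forall>\<^sub>F b :: real in at 0. b\<^sup>2 < exp (- 1)" by (rule order_tendstoD) simp
    moreover have "\<forall>\<^sub>F b :: real in at 0. b \<noteq> 0" by (simp add: eventually_at_filter)
    ultimately have "\<forall>\<^sub>F b in at 0. norm (r b) \<le> K * norm (b\<^sup>2 * ln (b\<^sup>2))"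
      by eventually_elim (use bound in simp)
    then have r: "r \<in> O[at 0](\<lambda>b. b\<^sup>2 * ln (b\<^sup>2))" by (rule bigoI)
    have m: "filterlim (\<lambda>b. - C * ln (b\<^sup>2)) at_top (at 0)"
      using filterlim_tendsto_pos_mult_at_top[OF tendsto_const C filterlim_minus_ln_square] by simp
    have f_eq: "f b = - C * ln (b\<^sup>2) + r b + k" for b by (simp add: r_def)
    note expansion = unbounded_expansion_at_0[OF r tendsto_square_mult_ln_square m f_eq]
    show "\<not> bounded (range f) \<and> filterlim f at_top (at 0)" using expansion by blast
    show "\<exists>c2>0. \<exists>r\<in>O[at 0](\<lambda>b. b\<^sup>2 * ln (b\<^sup>2)).
      f \<sim>[at 0] (\<lambda>b. - c2 * ln (b\<^sup>2) + r b)
      \<and> (\<exists>k. \<forall>b. b \<noteq> 0 \<longrightarrow> f b = - c2 * ln (b\<^sup>2) + r b + k)"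
      by (intro exI[of _ C] conjI bexI[of _ r] exI[of _ k] allI impI C r expansion(2) f_eq)
  qed
  have L0: "L 0 = (\<integral>u. precision_weight c a2 u \<partial>lborel)" by (simp add: L_def)
  \<comment> \<open>Gives continuity for any admissible \<open>q\<close>, and differentiability once
    \<open>2 * q > 1\<close>.\<close>
  have holder: "\<bar>f b - f 0\<bar> \<le> C * (Gamma (1 - q) / q) * 2 powr - q * \<bar>b\<bar> powr (2 * q)"
    if q: "0 < q" "q < 1" "q \<le> c - 1/2" for q b
  proof -
    have "\<bar>f b - f 0\<bar> = C * \<bar>L (b\<^sup>2 / 2) - L 0\<bar>"
      using C by (simp add: f abs_mult flip: right_diff_distrib)
    also have "\<dots> \<le> C * (Gamma (1 - q) / q * (b\<^sup>2 / 2) powr q)"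
      unfolding L0 unfolding L_def using C laplace_precision_weight_continuity[OF c assms(2) q, of "b\<^sup>2 / 2"]
      by (intro mult_left_mono) auto
    finally show ?thesis unfolding half_square_powr by (simp add: mult_ac)
  qed
  have gt_half: "bounded (range f) \<and> isCont f 0" if gt: "1/2 < c"
  proof
    have "norm (f b) \<le> C * L 0" for b
    proof -
      have "0 \<le> L (b\<^sup>2 / 2)" unfolding L_def by (simp add: precision_weight_nonneg)
      moreover have "L (b\<^sup>2 / 2) \<le> L 0"
        unfolding L0 unfolding L_def
      proof (rule integral_mono'[OF integrable_precision_weight[OF c assms(2) gt] _ precision_weight_nonneg])
        fix u
        show "precision_weight c a2 u * exp (- (b\<^sup>2 / 2 * u)) \<le> precision_weight c a2 u"
        proof (cases "0 < u")
          case True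
          then show ?thesis by (intro mult_left_le precision_weight_nonneg) simp
        qed (simp add: precision_weight_def)
      qed
      ultimately show ?thesis using C by (simp add: f)
    qed
    then show "bounded (range f)" by (auto simp: bounded_iff)
    define q where "q = min (1/2) (c - 1/2)"
    have q: "0 < q" "q < 1" "q \<le> c - 1/2" using gt by (auto simp: q_def)
    show "isCont f 0"
      unfolding isCont_def
    proof (rule LIM_zero_cancel, rule Lim_null_comparison)
      show "\<forall>\<^sub>F b in at 0. norm (f b - f 0) \<le> C * (Gamma (1 - q) / q) * 2 powr - q * \<bar>b\<bar> powr (2 * q)"
        using holder[OF q] by simp
      show "((\<lambda>b. C * (Gamma (1 - q) / q) * 2 powr - q * \<bar>b\<bar> powr (2 * q)) \<longlongrightarrow> 0) (at 0)"
        using q by (intro tendsto_mult_right_zero tendsto_abs_powr_0) simp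
    qed
  qed
  have gt_1: "f differentiable (at 0)" if gt: "1 < c"
  proof -
    \<comment> \<open>\<open>c > 1\<close> leaves room for \<open>q\<close> strictly between 1/2 and
      1; the order \<open>2 * q\<close> then exceeds 1, and the derivative is 0.\<close>
    define q where "q = min (3/4) (c - 1/2)"
    have q: "0 < q" "q < 1" "q \<le> c - 1/2" and r: "1 < 2 * q" using gt by (auto simp: q_def min_def)
    have "(f has_real_derivative 0) (at 0)"
      by (rule has_real_derivative_if_expansion[OF _ r, where K = "C * (Gamma (1 - q) / q) * 2 powr - q"])
         (use holder[OF q] in simp)
    then show ?thesis by (auto simp: real_differentiable_def)
  qed
  have eq_1: "f differentiable (at 0 within {0..}) \<and> f differentiable (at 0 within {..0})" if eq: "c = 1"
  proof -
    \<comment> \<open>\<open>(b\<^sup>2 / 2) powr (1/2)\<close> is a multiple of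
      \<open>\<bar>b\<bar>\<close>, hence the opposite slopes \<open>- d\<close> and
      \<open>d\<close> on the two sides.\<close>
    define d where "d = C * (2 * Gamma (1/2)) * 2 powr - (1/2)"
    define K where "K = C * ((1 + a2) * (Gamma (1/4) / (3/4))) * 2 powr - (3/4)"
    have expansion: "\<bar>f b - f 0 + d * \<bar>b\<bar>\<bar> \<le> K * \<bar>b\<bar> powr (2 * (3/4))" for b
    proof -
      have "d * \<bar>b\<bar> = C * (2 * Gamma (1/2) * (b\<^sup>2 / 2) powr (1/2))"
        unfolding half_square_powr d_def by simp
      then have "f b - f 0 + d * \<bar>b\<bar> = C * (L (b\<^sup>2 / 2) - L 0 + 2 * Gamma (1/2) * (b\<^sup>2 / 2) powr (1/2))"
        by (simp add: f algebra_simps)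
      then have "\<bar>f b - f 0 + d * \<bar>b\<bar>\<bar> = C * \<bar>L (b\<^sup>2 / 2) - L 0 + 2 * Gamma (1/2) * (b\<^sup>2 / 2) powr (1/2)\<bar>"
        using C by (simp add: abs_mult)
      also have "\<dots> \<le> C * ((1 + a2) * (Gamma (1/4) / (3/4) * (b\<^sup>2 / 2) powr (3/4)))"
        unfolding L0 unfolding L_def using C laplace_precision_weight_one[OF c assms(2) eq, of "b\<^sup>2 / 2"]
        by (intro mult_left_mono) auto
      finally show ?thesis unfolding half_square_powr K_def by (simp add: mult_ac)
    qed
    have "(f has_real_derivative - d) (at 0 within {0..})"
    proof (rule has_real_derivative_if_expansion)
      show "\<bar>f y - f 0 - - d * y\<bar> \<le> K * \<bar>y\<bar> powr (2 * (3/4))" if "y \<in> {0..}" for y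
        using expansion[of y] that by simp
    qed simp
    moreover have "(f has_real_derivative d) (at 0 within {..0})"
    proof (rule has_real_derivative_if_expansion)
      show "\<bar>f y - f 0 - d * y\<bar> \<le> K * \<bar>y\<bar> powr (2 * (3/4))" if "y \<in> {..0}" for y
        using expansion[of y] that by simp
    qed simp
    ultimately show ?thesis by (auto simp: real_differentiable_def)
  qed
  have ge_1: "f differentiable (at 0 within {0..}) \<and> f differentiable (at 0 within {..0})" if ge: "1 \<le> c"
    using eq_1 gt_1 ge by (cases "c = 1") (auto intro: differentiable_at_withinI)
  have le_half: "\<not> bounded (range f) \<and> filterlim f at_top (at 0)" if "c \<le> 1/2"
  proof (cases "c = 1/2")
    case True
    then show ?thesis by (rule half_lim)
  next
    case False
    then have "c < 1/2" using that by simp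
    then show ?thesis by (rule less_lim)
  qed
  show ?thesis
    by (intro conjI[OF dist] conjI[OF impI[OF le_half]] conjI[OF impI[OF less]] conjI[OF impI[OF half]]
        conjI[OF impI[OF gt_half]] conjI[OF impI[OF gt_1]] impI[OF ge_1])
qed

end
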